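(* Let $1<p\leq 2$. Then there is a constant $c_p>0$ depending only on $p$ such that for every $f\in L^p(\mathrm{SU}(2))$, $$\sum_{l\in\frac12\mathbb{N}_0}(2l+1)^{\frac52p-4}\,\|\widehat{f}(l)\|^p_{\mathrm{HS}}\leq c_p\,\|f\|^p_{L^p(\mathrm{SU}(2))}.$$
   Context: $\mathrm{SU}(2)$ carries the normalized Haar measure $du$, and $\frac12\mathbb{N}_0=\{0,\frac12,1,\frac32,\dots\}$. For $l\in\frac12\mathbb{N}_0$, let $V_l$ be the $(2l+1)$-dimensional space of homogeneous polynomials of degree $2l$ in two complex variables $z=(z_1,z_2)$ (a row vector), and let $t^l$ be the irreducible representation $(t^l(u)P)(z)=P(zu)$ of $\mathrm{SU}(2)$ on $V_l$, written in a basis of $V_l$ making it a unitary matrix representation $t^l:\mathrm{SU}(2)\to \mathrm{U}(2l+1)$. Every irreducible unitary representation of $\mathrm{SU}(2)$ is equivalent to exactly one $t^l$. The Fourier coefficient of $f\in L^1(\mathrm{SU}(2))$ is the matrix $\widehat f(l)=\int_{\mathrm{SU}(2)}f(u)\,t^l(u)^*\,du\in\mathbb{C}^{(2l+1)\times(2l+1)}$. $\|M\|_{\mathrm{HS}}=(\operatorname{Tr}MM^* )^{1/2}$ is the Hilbert–Schmidt norm. *)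

theory Defs
  imports
    "Jordan_Normal_Form.Schur_Decomposition"
    "HOL-Analysis.Analysis"
    "HOL-Probability.Probability_Measure"
begin

no_notation Matrix.vec_index (infixl "$" 100)

definition SU2 :: "(complex^2^2) set" where
  "SU2 = {u. u ** map_matrix cnj (transpose u) = mat 1 \<and> det u = 1}"

text \<open>Left invariance and total mass 1 determine the measure uniquely; being a Borel measure on a
  compact metrizable group, it is automatically regular and also right invariant.\<close>

definition normalized_haar_SU2 :: "(complex^2^2) measure \<Rightarrow> bool" where
  "normalized_haar_SU2 \<mu> \<longleftrightarrow>
     sets \<mu> = sets (restrict_space borel SU2) \<and> prob_space \<mu> \<and>
     (\<forall>v\<in>SU2. distr \<mu> \<mu> (\<lambda>u. v ** u) = \<mu>)"

text \<open>Throughout, the half-integer \<open>l\<close> is encoded by the natural number \<open>n = 2 * l\<close>.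
  Polynomials over the infinite field of complex numbers are identified with polynomial functions.\<close>

definition hom_poly :: "nat \<Rightarrow> (complex^2 \<Rightarrow> complex) set" where
  "hom_poly n = {P. \<exists>c :: nat \<Rightarrow> complex. P = (\<lambda>z. \<Sum>k\<le>n. c k * (z$1)^k * (z$2)^(n - k))}"

definition SU2_rep :: "complex^2^2 \<Rightarrow> (complex^2 \<Rightarrow> complex) \<Rightarrow> complex^2 \<Rightarrow> complex" where
  "SU2_rep u P = (\<lambda>z. P (z v* u))"

definition lincomb :: "nat \<Rightarrow> (nat \<Rightarrow> complex^2 \<Rightarrow> complex) \<Rightarrow> complex Matrix.vec \<Rightarrow> complex^2 \<Rightarrow> complex" where
  "lincomb n e a = (\<lambda>z. \<Sum>i\<le>n. vec_index a i * e i z)"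

text \<open>An ordered basis \<open>e 0, \<dots>, e n\<close> of \<^term>\<open>hom_poly n\<close>: every element has a unique expansion.\<close>

definition hom_poly_basis :: "nat \<Rightarrow> (nat \<Rightarrow> complex^2 \<Rightarrow> complex) \<Rightarrow> bool" where
  "hom_poly_basis n e \<longleftrightarrow>
     (\<forall>i\<le>n. e i \<in> hom_poly n) \<and>
     (\<forall>P\<in>hom_poly n. \<exists>!a. a \<in> carrier_vec (n + 1) \<and> P = lincomb n e a)"

definition coords :: "nat \<Rightarrow> (nat \<Rightarrow> complex^2 \<Rightarrow> complex) \<Rightarrow> (complex^2 \<Rightarrow> complex) \<Rightarrow> complex Matrix.vec" where
  "coords n e P = (THE a. a \<in> carrier_vec (n + 1) \<and> P = lincomb n e a)"

definition rep_matrix :: "nat \<Rightarrow> (nat \<Rightarrow> complex^2 \<Rightarrow> complex) \<Rightarrow> complex^2^2 \<Rightarrow> complex Matrix.mat" where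
  "rep_matrix n e u =
     Matrix.mat (n + 1) (n + 1) (\<lambda>(i, j). vec_index (coords n e (SU2_rep u (e j))) i)"

definition unitary_mat :: "nat \<Rightarrow> complex Matrix.mat \<Rightarrow> bool" where
  "unitary_mat m M \<longleftrightarrow>
     M \<in> carrier_mat m m \<and> M * mat_adjoint M = 1\<^sub>m m \<and> mat_adjoint M * M = 1\<^sub>m m"

definition unitarizing_basis :: "nat \<Rightarrow> (nat \<Rightarrow> complex^2 \<Rightarrow> complex) \<Rightarrow> bool" where
  "unitarizing_basis n e \<longleftrightarrow>
     hom_poly_basis n e \<and> (\<forall>u\<in>SU2. unitary_mat (n + 1) (rep_matrix n e u))"

definition fourier_coeff ::
  "(complex^2^2) measure \<Rightarrow> (nat \<Rightarrow> complex^2 \<Rightarrow> complex) \<Rightarrow> (complex^2^2 \<Rightarrow> complex) \<Rightarrow> nat \<Rightarrow> complex Matrix.mat"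
where
  "fourier_coeff \<mu> e f n =
     Matrix.mat (n + 1) (n + 1)
       (\<lambda>(i, j). \<integral>u. f u * (mat_adjoint (rep_matrix n e u) $$ (i, j)) \<partial>\<mu>)"

definition mat_trace :: "complex Matrix.mat \<Rightarrow> complex" where
  "mat_trace M = (\<Sum>i<dim_row M. M $$ (i, i))"

text \<open>The trace below is a nonnegative real number, so taking its real part loses nothing.\<close>

definition hs_norm :: "complex Matrix.mat \<Rightarrow> real" where
  "hs_norm M = sqrt (Re (mat_trace (M * mat_adjoint M)))"

definition Lp_space :: "real \<Rightarrow> 'a measure \<Rightarrow> ('a \<Rightarrow> complex) set" where
  "Lp_space p \<mu> = {f \<in> borel_measurable \<mu>. integrable \<mu> (\<lambda>x. norm (f x) powr p)}"

definition Lp_norm :: "real \<Rightarrow> 'a measure \<Rightarrow> ('a \<Rightarrow> complex) \<Rightarrow> real" where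
  "Lp_norm p \<mu> f = (\<integral>x. norm (f x) powr p \<partial>\<mu>) powr (1 / p)"

end

theory Submission
  imports Defs "HOL-Library.Real_Mod"
begin

text \<open>
  Put \<open>d = 2l + 1\<close>, let \<open>T f (d)\<close> be \<open>d powr (5/2)\<close> times the Hilbert--Schmidt norm of the Fourier
  coefficient of \<open>f\<close> at \<open>l\<close>, and weigh the point \<open>d\<close> by \<open>1 / d\<^sup>4\<close>; the left-hand
  side of the inequality is then the \<open>p\<close>-th power of the weighted norm of \<open>T f\<close>. The operator \<open>T\<close> is of
  type \<open>(2, 2)\<close> by Bessel's inequality. It is of weak type \<open>(1, 1)\<close>: unitarity of the representation
  matrices gives \<open>T f (d) \<le> d\<^sup>3 \<parallel>f\<parallel>\<^sub>1\<close>, and the points \<open>d \<ge> s\<close> have total weight of order \<open>1 / s\<^sup>3\<close>. Marcinkiewicz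
  interpolation covers the exponents in between.

  Bessel's inequality needs the orthogonality of the matrix coefficients. Left invariance of the Haar
  measure makes the matrix of integrals of products of coefficients, with both column indices fixed,
  an intertwiner. In the basis of monomials, commuting with a torus element forces an intertwiner to
  preserve weights, and commuting with the rotation by 45 degrees then forces it to be scalar.
\<close>

subsection \<open>Homogeneous polynomials and the matrices of the representation\<close>

text \<open>Substituting one expansion into another multiplies their coefficient matrices. The
  factors on the right stand in the order of a matrix product, so composition, change of basis and
  coordinates all use this form.\<close>

lemma sum_scale_swap:
  fixes g :: "'c \<Rightarrow> 'a::comm_semiring_0"
  shows "(\<Sum>j\<in>J. a j * (\<Sum>l\<in>L. b j l * g l)) = (\<Sum>l\<in>L. (\<Sum>j\<in>J. b j l * a j) * g l)"
proof -
  have "(\<Sum>j\<in>J. a j * (\<Sum>l\<in>L. b j l * g l)) = (\<Sum>j\<in>J. \<Sum>l\<in>L. b j l * a j * g l)"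
    unfolding sum_distrib_left by (intro sum.cong refl) (simp add: mult_ac)
  also have "\<dots> = (\<Sum>l\<in>L. \<Sum>j\<in>J. b j l * a j * g l)" by (rule sum.swap)
  finally show ?thesis by (simp only: sum_distrib_right)
qed

definition monomial_fun :: "nat \<Rightarrow> nat \<Rightarrow> complex^2 \<Rightarrow> complex" where
  "monomial_fun n k = (\<lambda>z. (z$1)^k * (z$2)^(n - k))"

lemma hom_poly_monomial_fun: "hom_poly n = {P. \<exists>c. P = (\<lambda>z. \<Sum>k\<le>n. c k * monomial_fun n k z)}"
  by (simp add: hom_poly_def monomial_fun_def mult.assoc)

text \<open>Continuity is demanded of the coefficients, not of the values, because the entries of
  \<open>rep_matrix\<close> are later obtained from these coefficients by a constant matrix. One
  induction on such families then yields both the invariance of \<open>hom_poly n\<close> and the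
  measurability of the matrix entries.\<close>

definition hom_family :: "nat \<Rightarrow> ('a::topological_space \<Rightarrow> complex^2 \<Rightarrow> complex) \<Rightarrow> bool" where
  "hom_family n P \<longleftrightarrow> (\<exists>c. (\<forall>k. continuous_on UNIV (\<lambda>u. c u k)) \<and>
     (\<forall>u. P u = (\<lambda>z. \<Sum>k\<le>n. c u k * monomial_fun n k z)))"

lemma hom_familyD: "hom_family n P \<Longrightarrow> P u \<in> hom_poly n"
  unfolding hom_family_def hom_poly_monomial_fun by blast

lemma hom_family_linear_mult:
  assumes "hom_family n P" "continuous_on UNIV \<alpha>" "continuous_on UNIV \<beta>"
  shows "hom_family (Suc n) (\<lambda>u z. (\<alpha> u * z$1 + \<beta> u * z$2) * P u z)"
proof -
  obtain c where c: "\<And>k. continuous_on UNIV (\<lambda>u. c u k)"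
    and P: "\<And>u. P u = (\<lambda>z. \<Sum>k\<le>n. c u k * monomial_fun n k z)"
    using assms(1) unfolding hom_family_def by blast
  \<comment> \<open>The factor \<open>z$1\<close> raises the exponent \<open>k\<close> and
    \<open>z$2\<close> keeps it. The guards drop the missing predecessor at \<open>k = 0\<close>,
    where \<open>k - 1\<close> would again be 0, and the value \<open>c u (Suc n)\<close>, which
    lies outside the expansion of \<open>P u\<close>.\<close>
  define d where "d u k = (if k = 0 then 0 else \<alpha> u * c u (k - 1)) + (if k \<le> n then \<beta> u * c u k else 0)"
    for u k
  have "continuous_on UNIV (\<lambda>u. d u k)" for k
    unfolding d_def using c assms(2,3)
    by (cases "k = 0"; cases "k \<le> n") (simp_all add: continuous_on_add continuous_on_mult)
  moreover have "(\<alpha> u * z$1 + \<beta> u * z$2) * P u z = (\<Sum>k\<le>Suc n. d u k * monomial_fun (Suc n) k z)" for u z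
  proof -
    have "(\<Sum>k\<le>Suc n. d u k * monomial_fun (Suc n) k z)
      = (\<Sum>k\<le>Suc n. (if k = 0 then 0 else \<alpha> u * c u (k - 1)) * monomial_fun (Suc n) k z)
      + (\<Sum>k\<le>Suc n. (if k \<le> n then \<beta> u * c u k else 0) * monomial_fun (Suc n) k z)"
      unfolding d_def sum.distrib[symmetric] by (simp only: distrib_right)
    also have "(\<Sum>k\<le>Suc n. (if k = 0 then 0 else \<alpha> u * c u (k - 1)) * monomial_fun (Suc n) k z)
      = (\<Sum>k\<le>n. \<alpha> u * z$1 * (c u k * monomial_fun n k z))"
      by (subst sum.atMost_Suc_shift) (simp add: monomial_fun_def mult_ac)
    also have "(\<Sum>k\<le>Suc n. (if k \<le> n then \<beta> u * c u k else 0) * monomial_fun (Suc n) k z)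
      = (\<Sum>k\<le>n. \<beta> u * z$2 * (c u k * monomial_fun n k z))"
      by (simp add: monomial_fun_def mult_ac Suc_diff_le)
    finally show ?thesis by (simp add: P sum_distrib_left distrib_right)
  qed
  ultimately show ?thesis unfolding hom_family_def by blast
qed

lemma hom_family_scale_sum:
  assumes "\<And>i. i \<in> I \<Longrightarrow> hom_family n (P i)" "finite I"
  shows "hom_family n (\<lambda>u z. \<Sum>i\<in>I. a i * P i u z)"
proof -
  obtain c where c: "\<And>i k. i \<in> I \<Longrightarrow> continuous_on UNIV (\<lambda>u. c i u k)"
    and P: "\<And>i u. i \<in> I \<Longrightarrow> P i u = (\<lambda>z. \<Sum>k\<le>n. c i u k * monomial_fun n k z)"
    using assms(1) unfolding hom_family_def by metis
  show ?thesis unfolding hom_family_def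
  proof (intro exI[of _ "\<lambda>u k. \<Sum>i\<in>I. a i * c i u k"] conjI allI ext)
    show "continuous_on UNIV (\<lambda>u. \<Sum>i\<in>I. a i * c i u k)" for k
      using c by (intro continuous_on_sum continuous_on_mult continuous_on_const) auto
    show "(\<Sum>i\<in>I. a i * P i u z) = (\<Sum>k\<le>n. (\<Sum>i\<in>I. a i * c i u k) * monomial_fun n k z)" for u z
      by (simp add: P sum_distrib_left sum_distrib_right mult.assoc)
        (rule sum.swap)
  qed
qed

text \<open>Both coordinates of \<open>z v* u\<close> are linear forms in \<open>z\<close> whose
  coefficients are entries of \<open>u\<close>. The product is built one linear factor at a time:
  first the powers of the second form, then the factors of the first.\<close>

lemma hom_family_monomial_fun:
  assumes "k \<le> n"
  shows "hom_family n (\<lambda>u z. monomial_fun n k (z v* u))"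
proof -
  have cont: "continuous_on UNIV (\<lambda>u::complex^2^2. u$a$b)" for a b
    by (intro continuous_on_component continuous_on_id)
  have lin: "(z v* u)$b = u$1$b * z$1 + u$2$b * z$2" for z :: "complex^2" and u :: "complex^2^2" and b
    by (simp add: vector_matrix_mult_def sum_2 mult.commute)
  have "hom_family l (\<lambda>(u::complex^2^2) z. ((z v* u)$2)^l)" for l
  proof (induction l)
    case 0
    show ?case unfolding hom_family_def
      by (intro exI[of _ "\<lambda>_ _. 1"]) (simp add: monomial_fun_def)
  next
    case (Suc l)
    show ?case
      using hom_family_linear_mult[OF Suc cont[of 1 2] cont[of 2 2]] by (simp only: lin power_Suc)
  qed
  then have "hom_family (j + l) (\<lambda>(u::complex^2^2) z. ((z v* u)$1)^j * ((z v* u)$2)^l)" for j l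
  proof (induction j)
    case 0
    then show ?case by simp
  next
    case (Suc j)
    show ?case
      using hom_family_linear_mult[OF Suc.IH[OF Suc.prems] cont[of 1 1] cont[of 2 1]]
      by (simp only: lin power_Suc add_Suc mult.assoc)
  qed
  from this[of k "n - k"] assms show ?thesis by (simp add: monomial_fun_def)
qed

lemma hom_family_SU2_rep:
  assumes "P \<in> hom_poly n"
  shows "hom_family n (\<lambda>u. SU2_rep u P)"
proof -
  obtain c where P: "P = (\<lambda>z. \<Sum>k\<le>n. c k * monomial_fun n k z)"
    using assms unfolding hom_poly_monomial_fun by blast
  have "hom_family n (\<lambda>u z. \<Sum>k\<le>n. c k * monomial_fun n k (z v* u))"
    by (intro hom_family_scale_sum hom_family_monomial_fun) auto
  then show ?thesis by (simp add: SU2_rep_def P)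
qed

text \<open>Setting the second variable to 1 turns a homogeneous polynomial into a polynomial in one
  variable with the same coefficients.\<close>

lemma monomials_independent:
  assumes "\<And>z. (\<Sum>k\<le>n. a k * monomial_fun n k z) = (\<Sum>k\<le>n. b k * monomial_fun n k z)"
    and "k \<le> n"
  shows "a k = b k"
proof -
  have "(\<Sum>k\<le>n. a k * x^k) = (\<Sum>k\<le>n. b k * x^k)" for x
    using assms(1)[of "vector [x, 1]"] by (simp add: monomial_fun_def)
  then show ?thesis using assms(2) polyfun_eq_coeffs[of a n b] by blast
qed

lemma monomial_fun_in_hom_poly:
  assumes "k \<le> n"
  shows "monomial_fun n k \<in> hom_poly n"
  unfolding hom_poly_monomial_fun
  by (rule CollectI, rule exI[of _ "\<lambda>i. if i = k then 1 else 0"])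
    (use assms in \<open>simp add: fun_eq_iff if_distrib[of "\<lambda>x. x * _"] sum.delta cong: if_cong\<close>)

section \<open>The adjoint matrix and the Hilbert--Schmidt norm\<close>

lemma mat_adjoint_index:
  "i < dim_col A \<Longrightarrow> j < dim_row A \<Longrightarrow> mat_adjoint A $$ (i, j) = conjugate (A $$ (j, i))"
  by (simp add: mat_adjoint_def mat_of_rows_def)

lemma mat_adjoint_dim: "dim_row (mat_adjoint A) = dim_col A" "dim_col (mat_adjoint A) = dim_row A"
  by (simp_all add: mat_adjoint_def)

lemma mult_mat_adjoint_index:
  fixes A B :: "complex Matrix.mat"
  assumes "i < dim_row A" "j < dim_row B" "dim_col A = dim_col B"
  shows "(A * mat_adjoint B) $$ (i, j) = (\<Sum>k<dim_col B. A $$ (i, k) * cnj (B $$ (j, k)))"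
proof -
  have "(A * mat_adjoint B) $$ (i, j) = (\<Sum>k<dim_col B. A $$ (i, k) * mat_adjoint B $$ (k, j))"
    using assms by (simp add: times_mat_def scalar_prod_def mat_adjoint_dim atLeast0LessThan)
  also have "\<dots> = (\<Sum>k<dim_col B. A $$ (i, k) * cnj (B $$ (j, k)))"
    using assms by (intro sum.cong refl) (simp add: mat_adjoint_index)
  finally show ?thesis .
qed

lemma hs_norm_sum: "hs_norm M = sqrt (\<Sum>i<dim_row M. \<Sum>j<dim_col M. (norm (M $$ (i,j)))\<^sup>2)"
proof -
  have "mat_trace (M * mat_adjoint M) = of_real (\<Sum>i<dim_row M. \<Sum>j<dim_col M. (norm (M $$ (i,j)))\<^sup>2)"
    unfolding mat_trace_def of_real_sum
    by (intro sum.cong) (simp_all add: mult_mat_adjoint_index complex_norm_square del: index_mult_mat(1) of_real_power)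
  then show ?thesis by (simp add: hs_norm_def)
qed

section \<open>Coordinates and change of basis\<close>

lemma coords_lincomb:
  assumes "hom_poly_basis n e" "P \<in> hom_poly n"
  shows "coords n e P \<in> carrier_vec (n + 1)" "P = lincomb n e (coords n e P)"
  using theI'[OF bspec[OF conjunct2[OF assms(1)[unfolded hom_poly_basis_def]] assms(2)]]
  unfolding coords_def by auto

lemma coords_unique:
  assumes "hom_poly_basis n e" "P \<in> hom_poly n" "a \<in> carrier_vec (n + 1)" "P = lincomb n e a"
  shows "coords n e P = a"
  using assms coords_lincomb[OF assms(1,2)] unfolding hom_poly_basis_def by metis

lemma SU2_rep_hom_poly: "P \<in> hom_poly n \<Longrightarrow> SU2_rep u P \<in> hom_poly n"
  by (rule hom_familyD[OF hom_family_SU2_rep])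

lemma SU2_rep_basis:
  assumes "hom_poly_basis n e" "j \<le> n"
  shows "e j (z v* u) = (\<Sum>i\<le>n. rep_matrix n e u $$ (i, j) * e i z)"
proof -
  have "e j \<in> hom_poly n" using assms by (simp add: hom_poly_basis_def)
  from coords_lincomb(2)[OF assms(1) SU2_rep_hom_poly[OF this, of u]]
  have "SU2_rep u (e j) z = lincomb n e (coords n e (SU2_rep u (e j))) z" by simp
  then show ?thesis using assms(2) by (simp add: SU2_rep_def lincomb_def rep_matrix_def)
qed

lemma basis_combination_unique:
  assumes "hom_poly_basis n e" "\<And>z. (\<Sum>i\<le>n. a i * e i z) = (\<Sum>i\<le>n. b i * e i z)" "i \<le> n"
    and P: "(\<lambda>z. \<Sum>i\<le>n. a i * e i z) \<in> hom_poly n"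
  shows "a i = b i"
proof -
  have "coords n e (\<lambda>z. \<Sum>i\<le>n. a i * e i z) = Matrix.vec (n+1) a"
    by (rule coords_unique[OF assms(1) P]) (auto simp: lincomb_def)
  moreover have "coords n e (\<lambda>z. \<Sum>i\<le>n. a i * e i z) = Matrix.vec (n+1) b"
    by (rule coords_unique[OF assms(1) P]) (auto simp: lincomb_def assms(2))
  ultimately have "vec_index (Matrix.vec (n+1) a) i = vec_index (Matrix.vec (n+1) b) i" by simp
  then show ?thesis using assms(3) by simp
qed

lemma rep_matrix_carrier: "rep_matrix n e u \<in> carrier_mat (n + 1) (n + 1)"
  by (simp add: rep_matrix_def)

text \<open>The columns of \<open>E\<close> hold the given basis in terms of monomials, those of
  \<open>F\<close> the monomials in terms of the basis. These matrices carry the intertwiner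
  argument, which is done with monomials, back to an arbitrary unitarizing basis.\<close>

lemma basis_change:
  assumes "hom_poly_basis n e"
  obtains E F where "E \<in> carrier_mat (n+1) (n+1)" "F \<in> carrier_mat (n+1) (n+1)"
    "F * E = 1\<^sub>m (n+1)" "E * F = 1\<^sub>m (n+1)"
    "\<And>j z. j \<le> n \<Longrightarrow> e j z = (\<Sum>k\<le>n. E $$ (k,j) * monomial_fun n k z)"
    "\<And>k z. k \<le> n \<Longrightarrow> monomial_fun n k z = (\<Sum>j\<le>n. F $$ (j,k) * e j z)"
proof -
  have "\<exists>c. \<forall>z. e j z = (\<Sum>k\<le>n. c k * monomial_fun n k z)" if "j \<le> n" for j
  proof -
    have "e j \<in> hom_poly n" using assms that by (simp add: hom_poly_basis_def)
    then show ?thesis unfolding hom_poly_monomial_fun by auto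
  qed
  then obtain c where c: "\<And>j z. j \<le> n \<Longrightarrow> e j z = (\<Sum>k\<le>n. c j k * monomial_fun n k z)" by metis
  define E where "E = Matrix.mat (n+1) (n+1) (\<lambda>(k,j). c j k)"
  define F where "F = Matrix.mat (n+1) (n+1) (\<lambda>(j,k). vec_index (coords n e (monomial_fun n k)) j)"
  have E: "E \<in> carrier_mat (n+1) (n+1)" and F: "F \<in> carrier_mat (n+1) (n+1)"
    by (auto simp: E_def F_def)
  have eE: "e j z = (\<Sum>k\<le>n. E $$ (k,j) * monomial_fun n k z)" if "j \<le> n" for j z
    using c[OF that] that by (simp add: E_def)
  have mF: "monomial_fun n k z = (\<Sum>j\<le>n. F $$ (j,k) * e j z)" if "k \<le> n" for k z
    using fun_cong[OF coords_lincomb(2)[OF assms monomial_fun_in_hom_poly[OF that]], of z] that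
    by (simp add: F_def lincomb_def)
  have EF: "E * F = 1\<^sub>m (n+1)"
  proof (rule eq_matI)
    fix l k assume lk: "l < dim_row (1\<^sub>m (n+1) :: complex Matrix.mat)" "k < dim_col (1\<^sub>m (n+1) :: complex Matrix.mat)"
    then have kn: "k \<le> n" "l \<le> n" by auto
    have "(\<Sum>l\<le>n. (if l = k then 1 else 0) * monomial_fun n l z) = (\<Sum>l\<le>n. (E * F) $$ (l,k) * monomial_fun n l z)" for z
    proof -
      have "(\<Sum>l\<le>n. (if l = k then 1 else 0) * monomial_fun n l z) = monomial_fun n k z"
        using kn by (simp add: if_distrib[of "\<lambda>x. x * _"] sum.delta cong: if_cong)
      also have "\<dots> = (\<Sum>j\<le>n. F $$ (j,k) * (\<Sum>l\<le>n. E $$ (l,j) * monomial_fun n l z))"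
        by (simp add: mF[OF kn(1)] eE)
      also have "\<dots> = (\<Sum>l\<le>n. (\<Sum>j\<le>n. E $$ (l,j) * F $$ (j,k)) * monomial_fun n l z)"
        by (rule sum_scale_swap)
      also have "\<dots> = (\<Sum>l\<le>n. (E * F) $$ (l,k) * monomial_fun n l z)"
        using E F kn by (intro sum.cong refl) (auto simp: scalar_prod_def atLeast0LessThan lessThan_Suc_atMost)
      finally show ?thesis .
    qed
    from monomials_independent[OF this kn(2)]
    show "(E * F) $$ (l,k) = 1\<^sub>m (n+1) $$ (l,k)" using kn by auto
  qed (use E F in auto)
  \<comment> \<open>For square matrices a one-sided inverse is two-sided, so independence of the
    monomials suffices.\<close>
  from mat_mult_left_right_inverse[OF E F EF] EF E F eE mF show ?thesis by (intro that)
qed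

text \<open>\<open>coords\<close> is defined by a description operator, which hides its dependence
  on \<open>u\<close>. The coefficients with respect to monomials are continuous in
  \<open>u\<close>, and the constant matrix \<open>F\<close> turns them into coordinates for
  \<open>e\<close>.\<close>

lemma continuous_rep_matrix:
  assumes "hom_poly_basis n e" "i \<le> n" "j \<le> n"
  shows "continuous_on UNIV (\<lambda>u. rep_matrix n e u $$ (i, j))"
proof -
  obtain F where F: "\<And>k z. k \<le> n \<Longrightarrow> monomial_fun n k z = (\<Sum>j\<le>n. F $$ (j,k) * e j z)"
    using basis_change[OF assms(1)] by metis
  have ej: "e j \<in> hom_poly n" using assms by (simp add: hom_poly_basis_def)
  from hom_family_SU2_rep[OF ej] obtain c where c: "\<And>k. continuous_on UNIV (\<lambda>u. c u k)"
     and P: "\<And>u. SU2_rep u (e j) = (\<lambda>z. \<Sum>k\<le>n. c u k * monomial_fun n k z)"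
    unfolding hom_family_def by metis
  have "rep_matrix n e u $$ (i, j) = (\<Sum>k\<le>n. F $$ (i, k) * c u k)" for u
  proof (rule basis_combination_unique[OF assms(1) _ assms(2)])
    have 1: "(\<lambda>z. \<Sum>i\<le>n. rep_matrix n e u $$ (i, j) * e i z) = SU2_rep u (e j)"
      using SU2_rep_basis[OF assms(1,3)] by (simp add: SU2_rep_def)
    then show "(\<lambda>z. \<Sum>i\<le>n. rep_matrix n e u $$ (i, j) * e i z) \<in> hom_poly n"
      using SU2_rep_hom_poly[OF ej] by simp
    show "(\<Sum>i\<le>n. rep_matrix n e u $$ (i, j) * e i z) = (\<Sum>i\<le>n. (\<Sum>k\<le>n. F $$ (i, k) * c u k) * e i z)" for z
    proof -
      have "(\<Sum>i\<le>n. rep_matrix n e u $$ (i, j) * e i z) = SU2_rep u (e j) z"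
        using fun_cong[OF 1] .
      also have "\<dots> = (\<Sum>k\<le>n. c u k * (\<Sum>j\<le>n. F $$ (j,k) * e j z))"
        unfolding P by (intro sum.cong refl) (simp add: F)
      finally show ?thesis by (simp only: sum_scale_swap)
    qed
  qed
  moreover have "continuous_on UNIV (\<lambda>u. \<Sum>k\<le>n. F $$ (i, k) * c u k)"
    using c by (intro continuous_on_sum continuous_on_mult continuous_on_const)
  ultimately show ?thesis by simp
qed

text \<open>With row vectors, \<open>z v* (v ** u) = (z v* v) v* u\<close>, so the action preserves
  the order of products; expanding twice in the basis gives the matrix product.\<close>

lemma rep_matrix_mult:
  assumes "hom_poly_basis n e" "i \<le> n" "j \<le> n"
  shows "rep_matrix n e (v ** u) $$ (i, j) = (\<Sum>k\<le>n. rep_matrix n e v $$ (i, k) * rep_matrix n e u $$ (k, j))"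
proof (rule basis_combination_unique[OF assms(1) _ assms(2)])
  have ej: "e j \<in> hom_poly n" using assms by (simp add: hom_poly_basis_def)
  have 1: "(\<lambda>z. \<Sum>i\<le>n. rep_matrix n e (v ** u) $$ (i, j) * e i z) = SU2_rep (v ** u) (e j)"
    using SU2_rep_basis[OF assms(1,3)] by (simp add: SU2_rep_def)
  then show "(\<lambda>z. \<Sum>i\<le>n. rep_matrix n e (v ** u) $$ (i, j) * e i z) \<in> hom_poly n"
    using SU2_rep_hom_poly[OF ej] by simp
  show "(\<Sum>i\<le>n. rep_matrix n e (v ** u) $$ (i, j) * e i z) =
      (\<Sum>i\<le>n. (\<Sum>k\<le>n. rep_matrix n e v $$ (i, k) * rep_matrix n e u $$ (k, j)) * e i z)" for z
  proof -
    have "(\<Sum>i\<le>n. rep_matrix n e (v ** u) $$ (i, j) * e i z) = e j ((z v* v) v* u)"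
      using fun_cong[OF 1] by (simp add: SU2_rep_def vector_matrix_mul_assoc)
    also have "\<dots> = (\<Sum>k\<le>n. rep_matrix n e u $$ (k, j) * e k (z v* v))"
      by (rule SU2_rep_basis[OF assms(1,3)])
    also have "\<dots> = (\<Sum>k\<le>n. rep_matrix n e u $$ (k, j) * (\<Sum>i\<le>n. rep_matrix n e v $$ (i, k) * e i z))"
      using SU2_rep_basis[OF assms(1)] by (intro sum.cong refl) simp
    finally show ?thesis by (simp only: sum_scale_swap)
  qed
qed

subsection \<open>Intertwiners between the representations are scalar\<close>

lemma SU2_mult: "u \<in> SU2 \<Longrightarrow> v \<in> SU2 \<Longrightarrow> u ** v \<in> SU2"
proof -
  assume u: "u \<in> SU2" and v: "v \<in> SU2"
  have "map_matrix cnj (transpose (u ** v)) = map_matrix cnj (transpose v) ** map_matrix cnj (transpose u)"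
    by (simp add: map_matrix_def matrix_matrix_mult_def transpose_def vec_eq_iff mult.commute)
  then have "u ** v ** map_matrix cnj (transpose (u ** v))
      = u ** (v ** map_matrix cnj (transpose v)) ** map_matrix cnj (transpose u)"
    by (simp add: matrix_mul_assoc)
  also have "\<dots> = mat 1" using u v by (simp add: SU2_def)
  finally show ?thesis using u v by (simp add: SU2_def det_mul)
qed

text \<open>The parametrization of \<open>SU2\<close> by the unit sphere of pairs
  \<open>(a, b)\<close>.\<close>

lemma SU2_intro:
  assumes "a * cnj a + b * cnj b = 1"
  shows "vector [vector [a, - cnj b], vector [b, cnj a]] \<in> SU2"
  using assms
  by (simp add: SU2_def vec_eq_iff forall_2 sum_2 matrix_matrix_mult_def transpose_def map_matrix_def
      mat_def det_2 mult.commute add.commute)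

text \<open>Conjugation by the change of basis gives the matrix of the same action with respect to
  monomials.\<close>

lemma monomial_rep:
  assumes basis: "hom_poly_basis n e" and E: "E \<in> carrier_mat (n+1) (n+1)" and F: "F \<in> carrier_mat (n+1) (n+1)"
    and eE: "\<And>j z. j \<le> n \<Longrightarrow> e j z = (\<Sum>k\<le>n. E $$ (k,j) * monomial_fun n k z)"
    and mF: "\<And>k z. k \<le> n \<Longrightarrow> monomial_fun n k z = (\<Sum>j\<le>n. F $$ (j,k) * e j z)"
    and kn: "k \<le> n"
  shows "monomial_fun n k (z v* u) = (\<Sum>l\<le>n. (E * rep_matrix n e u * F) $$ (l,k) * monomial_fun n l z)"
proof -
  let ?t = "rep_matrix n e u"
  have idx: "(A * B) $$ (i, j) = (\<Sum>k\<le>n. A $$ (i, k) * B $$ (k, j))"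
    if "A \<in> carrier_mat (n+1) (n+1)" "B \<in> carrier_mat (n+1) (n+1)" "i \<le> n" "j \<le> n"
    for A B :: "complex Matrix.mat" and i j
    using that by (auto simp: scalar_prod_def atLeast0LessThan lessThan_Suc_atMost)
  have t: "?t \<in> carrier_mat (n+1) (n+1)" by (rule rep_matrix_carrier)
  have "monomial_fun n k (z v* u) = (\<Sum>j\<le>n. F $$ (j,k) * (\<Sum>i\<le>n. ?t $$ (i, j) * e i z))"
    unfolding mF[OF kn] using SU2_rep_basis[OF basis] by (intro sum.cong refl) simp
  also have "\<dots> = (\<Sum>i\<le>n. (?t * F) $$ (i, k) * e i z)"
    unfolding sum_scale_swap using idx[OF t F _ kn] by (intro sum.cong refl) simp
  also have "\<dots> = (\<Sum>i\<le>n. (?t * F) $$ (i, k) * (\<Sum>l\<le>n. E $$ (l, i) * monomial_fun n l z))"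
    using eE by (intro sum.cong refl) simp
  also have "\<dots> = (\<Sum>l\<le>n. (E * (?t * F)) $$ (l, k) * monomial_fun n l z)"
    unfolding sum_scale_swap using idx[OF E mult_carrier_mat[OF t F] _ kn] by (intro sum.cong refl) simp
  also have "E * (?t * F) = E * ?t * F" using assoc_mult_mat[OF E t F] by simp
  finally show ?thesis .
qed

text \<open>The redundant \<open>- cnj 0\<close> keeps the shape of \<open>SU2_intro\<close>, which
  then applies directly; \<open>rot\<close> is written in the same way.\<close>

definition torus :: "real \<Rightarrow> complex^2^2" where
  "torus \<theta> = vector [vector [cis \<theta>, - cnj 0], vector [0, cnj (cis \<theta>)]]"

definition rot :: "complex^2^2" where
  "rot = vector [vector [complex_of_real (1 / sqrt 2), - cnj (of_real (1 / sqrt 2))],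
    vector [of_real (1 / sqrt 2), cnj (of_real (1 / sqrt 2))]]"

lemma torus_SU2: "torus \<theta> \<in> SU2"
  unfolding torus_def by (rule SU2_intro) (simp add: cis_cnj cis_mult)

lemma rot_SU2: "rot \<in> SU2"
  unfolding rot_def by (rule SU2_intro) (simp add: complex_eq_iff power2_eq_square[symmetric] power_divide)

text \<open>Monomials are weight vectors of the diagonal torus: \<open>z$1\<close> is scaled by
  \<open>cis \<theta>\<close> and \<open>z$2\<close> by its inverse, so the exponents contribute
  \<open>k - (n - k)\<close>.\<close>

lemma monomial_fun_torus:
  assumes "k \<le> n"
  shows "monomial_fun n k (z v* torus \<theta>) = cis (\<theta> * (2 * real k - real n)) * monomial_fun n k z"
proof -
  have "cis \<theta> ^ k * cis (- \<theta>) ^ (n - k) = cis (\<theta> * (2 * real k - real n))"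
    using assms by (simp add: Complex.DeMoivre cis_mult of_nat_diff algebra_simps)
  then show ?thesis
    by (simp add: torus_def monomial_fun_def vector_matrix_mult_def sum_2 power_mult_distrib cis_cnj mult_ac)
qed

text \<open>The binomial theorem for the image of the highest weight vector. What matters below is
  that every monomial occurs in it with a nonzero coefficient.\<close>

lemma monomial_fun_rot:
  "monomial_fun n n (z v* rot) = (\<Sum>k\<le>n. of_nat (n choose k) * complex_of_real (1 / sqrt 2) ^ n * monomial_fun n k z)"
proof -
  have "monomial_fun n n (z v* rot) = (complex_of_real (1 / sqrt 2) * (z$1 + z$2)) ^ n"
    by (simp add: rot_def monomial_fun_def vector_matrix_mult_def sum_2 distrib_left mult.commute del: of_real_divide)
  also have "\<dots> = (\<Sum>k\<le>n. of_nat (n choose k) * complex_of_real (1 / sqrt 2) ^ n * monomial_fun n k z)"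
    unfolding power_mult_distrib binomial_ring sum_distrib_left
    by (intro sum.cong refl) (simp add: monomial_fun_def)
  finally show ?thesis .
qed

text \<open>The matrices of the representation in the basis of monomials, described by what they do
  rather than as conjugates of \<open>rep_matrix\<close>. The intertwiner lemmas thus do not mention
  the original basis.\<close>

definition monomial_action :: "nat \<Rightarrow> (complex^2^2 \<Rightarrow> complex Matrix.mat) \<Rightarrow> bool" where
  "monomial_action n D \<longleftrightarrow> (\<forall>u. D u \<in> carrier_mat (n+1) (n+1)) \<and>
     (\<forall>u z. \<forall>k\<le>n. monomial_fun n k (z v* u) = (\<Sum>l\<le>n. D u $$ (l,k) * monomial_fun n l z))"

lemma monomial_actionD:
  assumes "monomial_action n D"
  shows "D u \<in> carrier_mat (n+1) (n+1)"
    and "k \<le> n \<Longrightarrow> monomial_fun n k (z v* u) = (\<Sum>l\<le>n. D u $$ (l,k) * monomial_fun n l z)"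
  using assms unfolding monomial_action_def by blast+

lemma monomial_action_torus:
  assumes "monomial_action n D" "k \<le> n" "l \<le> n"
  shows "D (torus \<theta>) $$ (l, k) = (if l = k then cis (\<theta> * (2 * real k - real n)) else 0)"
proof (rule monomials_independent[OF _ assms(3)])
  fix z
  have "(\<Sum>l\<le>n. D (torus \<theta>) $$ (l, k) * monomial_fun n l z) = monomial_fun n k (z v* torus \<theta>)"
    by (rule monomial_actionD(2)[OF assms(1,2), symmetric])
  also have "\<dots> = (\<Sum>l\<le>n. (if l = k then cis (\<theta> * (2 * real k - real n)) else 0) * monomial_fun n l z)"
    using assms(2) by (simp only: monomial_fun_torus) (simp add: if_distrib[of "\<lambda>x. x * _"] sum.delta cong: if_cong)
  finally show "(\<Sum>l\<le>n. D (torus \<theta>) $$ (l, k) * monomial_fun n l z) = \<dots>" .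
qed

lemma monomial_action_rot:
  assumes "monomial_action n D" "l \<le> n"
  shows "D rot $$ (l, n) = of_nat (n choose l) * complex_of_real (1 / sqrt 2) ^ n"
proof (rule monomials_independent[OF _ assms(2)])
  fix z
  have "(\<Sum>l\<le>n. D rot $$ (l, n) * monomial_fun n l z) = monomial_fun n n (z v* rot)"
    by (rule monomial_actionD(2)[OF assms(1) order_refl, symmetric])
  then show "(\<Sum>l\<le>n. D rot $$ (l, n) * monomial_fun n l z) =
     (\<Sum>l\<le>n. of_nat (n choose l) * complex_of_real (1 / sqrt 2) ^ n * monomial_fun n l z)"
    by (simp only: monomial_fun_rot)
qed

text \<open>Two weights differ by at most \<open>n + m\<close> in absolute value, so at the angle
  \<open>pi / (n + m + 1)\<close> their phases differ by less than \<open>pi\<close>. A single torus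
  element therefore separates all weights occurring in degrees \<open>n\<close> and
  \<open>m\<close>.\<close>

lemma cis_weight_inj:
  assumes "cis (pi / real (n + m + 1) * (2 * real k - real n)) = cis (pi / real (n + m + 1) * (2 * real i - real m))"
    and "k \<le> n" "i \<le> m"
  shows "2 * real k - real n = 2 * real i - real m"
proof -
  let ?N = "real (n + m + 1)"
  have "cis (pi / ?N * (2 * real k - real n) - pi / ?N * (2 * real i - real m)) = 1"
    unfolding cis_divide[symmetric] assms(1) by simp
  then obtain q :: int where q: "pi / ?N * (2 * real k - real n) - pi / ?N * (2 * real i - real m) = of_int q * (2 * pi)"
    unfolding cis_eq_1_iff by blast
  define d where "d = (2 * real k - real n) - (2 * real i - real m)"
  have "pi / ?N * d = of_int q * (2 * pi)" using q by (simp only: d_def right_diff_distrib)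
  then have "pi * d = pi * (of_int q * (2 * ?N))" by (simp add: field_simps)
  then have dq: "d = of_int q * (2 * ?N)" by simp
  have "\<bar>d\<bar> \<le> real n + real m" using assms(2,3) unfolding d_def by linarith
  then have *: "\<bar>of_int q\<bar> * (2 * ?N) \<le> real n + real m" unfolding dq by (simp add: abs_mult)
  have "q = 0"
  proof (rule ccontr)
    assume "q \<noteq> 0"
    then have "1 \<le> \<bar>real_of_int q\<bar>" by linarith
    then have "1 * (2 * ?N) \<le> \<bar>of_int q\<bar> * (2 * ?N)" by (intro mult_right_mono) auto
    then have "2 * ?N \<le> real n + real m" using * by linarith
    then show False by simp
  qed
  then show ?thesis using dq by (simp add: d_def)
qed

text \<open>Both matrices of a torus element are diagonal. Comparing the \<open>(i, k)\<close>
  entries of the two products multiplies \<open>W $$ (i, k)\<close> by one phase or the other, so a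
  nonzero entry forces the phases to agree.\<close>

lemma intertwiner_weights:
  assumes D: "monomial_action n D" and D': "monomial_action m D'"
    and W: "W \<in> carrier_mat (m+1) (n+1)" "\<forall>u\<in>SU2. W * D u = D' u * W"
    and "i \<le> m" "k \<le> n" "W $$ (i, k) \<noteq> 0"
  shows "2 * real k - real n = 2 * real i - real m"
proof -
  let ?u = "torus (pi / real (n + m + 1))"
  have "(W * D ?u) $$ (i, k) = (\<Sum>l\<le>n. W $$ (i, l) * D ?u $$ (l, k))"
    using monomial_actionD(1)[OF D, of ?u] W(1) assms(5,6)
    by (simp add: scalar_prod_def atLeast0LessThan lessThan_Suc_atMost)
  also have "\<dots> = W $$ (i, k) * cis (pi / real (n + m + 1) * (2 * real k - real n))"
    using assms(6) by (simp add: monomial_action_torus[OF D] if_distrib[of "\<lambda>x. _ * x"] sum.delta cong: if_cong)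
  finally have 1: "(W * D ?u) $$ (i, k) = W $$ (i, k) * cis (pi / real (n + m + 1) * (2 * real k - real n))" .
  have "(D' ?u * W) $$ (i, k) = (\<Sum>l\<le>m. D' ?u $$ (i, l) * W $$ (l, k))"
    using monomial_actionD(1)[OF D', of ?u] W(1) assms(5,6)
    by (simp add: scalar_prod_def atLeast0LessThan lessThan_Suc_atMost)
  also have "\<dots> = cis (pi / real (n + m + 1) * (2 * real i - real m)) * W $$ (i, k)"
    using assms(5) by (simp add: monomial_action_torus[OF D'] if_distrib[of "\<lambda>x. x * _"] sum.delta cong: if_cong)
  finally have "cis (pi / real (n + m + 1) * (2 * real k - real n)) = cis (pi / real (n + m + 1) * (2 * real i - real m))"
    using 1 bspec[OF W(2) torus_SU2] assms(7) by simp
  then show ?thesis using assms by (intro cis_weight_inj)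
qed

text \<open>Only the last column is compared, since there the entries of \<open>D rot\<close> are
  known binomial multiples; \<open>D' rot\<close> stays unevaluated.\<close>

lemma intertwiner_rot:
  assumes D: "monomial_action n D" and D': "monomial_action m D'"
    and W: "W \<in> carrier_mat (m+1) (n+1)" "\<forall>u\<in>SU2. W * D u = D' u * W"
    and i: "i \<le> m"
  shows "(\<Sum>l\<le>n. W $$ (i, l) * (of_nat (n choose l) * complex_of_real (1 / sqrt 2) ^ n))
    = (\<Sum>l\<le>m. D' rot $$ (i, l) * W $$ (l, n))"
proof -
  have "(W * D rot) $$ (i, n) = (\<Sum>l\<le>n. W $$ (i, l) * D rot $$ (l, n))"
    using monomial_actionD(1)[OF D, of rot] W(1) i
    by (simp add: scalar_prod_def atLeast0LessThan lessThan_Suc_atMost)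
  moreover have "(D' rot * W) $$ (i, n) = (\<Sum>l\<le>m. D' rot $$ (i, l) * W $$ (l, n))"
    using monomial_actionD(1)[OF D', of rot] W(1) i
    by (simp add: scalar_prod_def atLeast0LessThan lessThan_Suc_atMost)
  ultimately show ?thesis using bspec[OF W(2) rot_SU2] by (simp add: monomial_action_rot[OF D])
qed

text \<open>The weight \<open>n\<close> exceeds every weight of degree \<open>m < n\<close>, so the
  last column of \<open>W\<close> vanishes and with it the right-hand side of
  \<open>intertwiner_rot\<close>. By weights, a nonzero entry would be the only one in its row; the
  left-hand side would then be that entry times a nonzero binomial multiple.\<close>

lemma intertwiner_zero:
  assumes D: "monomial_action n D" and D': "monomial_action m D'"
    and W: "W \<in> carrier_mat (m+1) (n+1)" "\<forall>u\<in>SU2. W * D u = D' u * W"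
    and "m < n"
  shows "W = 0\<^sub>m (m+1) (n+1)"
proof (rule eq_matI)
  fix i k assume "i < dim_row (0\<^sub>m (m+1) (n+1) :: complex Matrix.mat)" "k < dim_col (0\<^sub>m (m+1) (n+1) :: complex Matrix.mat)"
  then have ik: "i \<le> m" "k \<le> n" by auto
  note wt = intertwiner_weights[OF D D' W]
  have "W $$ (i, k) = 0"
  proof (rule ccontr)
    assume nz: "W $$ (i, k) \<noteq> 0"
    have 0: "W $$ (l, n) = 0" if "l \<le> m" for l
      using wt[OF that order_refl] that \<open>m < n\<close> by fastforce
    have "W $$ (i, l) = 0" if "l \<le> n" "l \<noteq> k" for l
      using wt[OF ik(1) that(1)] wt[OF ik nz] that(2) by fastforce
    then have "(\<Sum>l\<le>n. W $$ (i, l) * (of_nat (n choose l) * complex_of_real (1 / sqrt 2) ^ n))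
      = W $$ (i, k) * (of_nat (n choose k) * complex_of_real (1 / sqrt 2) ^ n)"
      using ik by (subst sum.remove[of _ k]) auto
    then show False
      using intertwiner_rot[OF D D' W ik(1)] 0 nz ik(2) by simp
  qed
  then show "W $$ (i, k) = 0\<^sub>m (m+1) (n+1) $$ (i, k)" using ik by simp
qed (use W in auto)

text \<open>Equality of weights makes \<open>W\<close> diagonal. The identity of
  \<open>intertwiner_rot\<close> then reads \<open>W $$ (i, i) * b = b * W $$ (n, n)\<close> with a
  nonzero binomial multiple \<open>b\<close>, so all diagonal entries agree.\<close>

lemma intertwiner_scalar:
  assumes D: "monomial_action n D"
    and W: "W \<in> carrier_mat (n+1) (n+1)" "\<forall>u\<in>SU2. W * D u = D u * W"
  shows "W = W $$ (n, n) \<cdot>\<^sub>m 1\<^sub>m (n+1)"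
proof (rule eq_matI)
  fix i k assume "i < dim_row (W $$ (n, n) \<cdot>\<^sub>m 1\<^sub>m (n+1))" "k < dim_col (W $$ (n, n) \<cdot>\<^sub>m 1\<^sub>m (n+1))"
  then have ik: "i \<le> n" "k \<le> n" by auto
  have off: "W $$ (i, k) = 0" if "i \<noteq> k" "i \<le> n" "k \<le> n" for i k
    using intertwiner_weights[OF D D W that(2,3)] that(1) by fastforce
  have "(\<Sum>l\<le>n. W $$ (i, l) * (of_nat (n choose l) * complex_of_real (1 / sqrt 2) ^ n))
      = W $$ (i, i) * (of_nat (n choose i) * complex_of_real (1 / sqrt 2) ^ n)"
    using ik off by (subst sum.remove[of _ i]) auto
  moreover have "(\<Sum>l\<le>n. D rot $$ (i, l) * W $$ (l, n)) = D rot $$ (i, n) * W $$ (n, n)"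
    using off by (subst sum.remove[of _ n]) auto
  ultimately have "W $$ (i, i) = W $$ (n, n)"
    using intertwiner_rot[OF D D W ik(1)] ik(1) by (simp add: monomial_action_rot[OF D])
  then show "W $$ (i, k) = (W $$ (n, n) \<cdot>\<^sub>m 1\<^sub>m (n+1)) $$ (i, k)"
    using ik off[OF _ ik] by (cases "i = k") simp_all
qed (use W in auto)

section \<open>Matrix products and entries of unitary matrices\<close>

lemma mat_index_mult_sum:
  fixes A B :: "'a::semiring_0 Matrix.mat"
  assumes "A \<in> carrier_mat a (b+1)" "B \<in> carrier_mat (b+1) c" "i < a" "j < c"
  shows "(A * B) $$ (i, j) = (\<Sum>k\<le>b. A $$ (i, k) * B $$ (k, j))"
  using assms by (auto simp: scalar_prod_def atLeast0LessThan lessThan_Suc_atMost)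

lemma mat_mult_assoc_dim:
  fixes A B C :: "'a::semiring_0 Matrix.mat"
  assumes "dim_col A = dim_row B" "dim_col B = dim_row C"
  shows "A * B * C = A * (B * C)"
  using assms by (intro assoc_mult_mat[of A "dim_row A" "dim_row B" B "dim_row C" C "dim_col C"]) auto

lemma unitary_rows_orthonormal:
  assumes "unitary_mat (n+1) M" "i \<le> n" "j \<le> n"
  shows "(\<Sum>k\<le>n. M $$ (i, k) * cnj (M $$ (j, k))) = (if i = j then 1 else 0)"
proof -
  have M: "M \<in> carrier_mat (n+1) (n+1)" "M * mat_adjoint M = 1\<^sub>m (n+1)"
    using assms by (auto simp: unitary_mat_def)
  have "(M * mat_adjoint M) $$ (i, j) = (\<Sum>k\<le>n. M $$ (i, k) * cnj (M $$ (j, k)))"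
    using M(1) assms by (subst mult_mat_adjoint_index) (auto simp: lessThan_Suc_atMost)
  then show ?thesis using M(2) assms by simp
qed

lemma unitary_cols_orthonormal:
  assumes "unitary_mat (n+1) M" "i \<le> n" "j \<le> n"
  shows "(\<Sum>k\<le>n. M $$ (k, j) * cnj (M $$ (k, i))) = (if i = j then 1 else 0)"
proof -
  have M: "M \<in> carrier_mat (n+1) (n+1)" "mat_adjoint M * M = 1\<^sub>m (n+1)"
    using assms by (auto simp: unitary_mat_def)
  have A: "mat_adjoint M \<in> carrier_mat (n+1) (n+1)"
    using M(1) by (auto simp: mat_adjoint_dim)
  have "(mat_adjoint M * M) $$ (i, j) = (\<Sum>k\<le>n. mat_adjoint M $$ (i, k) * M $$ (k, j))"
    using assms by (intro mat_index_mult_sum[OF A M(1)]) auto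
  also have "\<dots> = (\<Sum>k\<le>n. M $$ (k, j) * cnj (M $$ (k, i)))"
    using M(1) assms by (intro sum.cong refl) (simp add: mat_adjoint_index)
  finally show ?thesis using M(2) assms by simp
qed

lemma unitary_entry_le_1:
  assumes "unitary_mat (n+1) M" "i \<le> n" "j \<le> n"
  shows "norm (M $$ (i, j)) \<le> 1"
proof -
  have "of_real (\<Sum>k\<le>n. (norm (M $$ (i, k)))\<^sup>2) = (\<Sum>k\<le>n. M $$ (i, k) * cnj (M $$ (i, k)))"
    unfolding of_real_sum complex_norm_square ..
  also have "\<dots> = of_real 1" using unitary_rows_orthonormal[OF assms(1,2,2)] by simp
  finally have "(\<Sum>k\<le>n. (norm (M $$ (i, k)))\<^sup>2) = 1" by (simp only: of_real_eq_iff)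
  moreover have "(norm (M $$ (i, j)))\<^sup>2 \<le> (\<Sum>k\<le>n. (norm (M $$ (i, k)))\<^sup>2)"
    using assms(3) by (intro member_le_sum) auto
  ultimately have "(norm (M $$ (i, j)))\<^sup>2 \<le> 1\<^sup>2" by simp
  then show ?thesis by (rule power2_le_imp_le) simp
qed

section \<open>Integration against Haar measure and inner products of matrix coefficients\<close>

lemma space_haar: "normalized_haar_SU2 \<mu> \<Longrightarrow> space \<mu> = SU2"
  using sets_eq_imp_space_eq[of \<mu> "restrict_space borel SU2"]
  by (simp add: normalized_haar_SU2_def space_restrict_space)

lemma haar_borel_measurable:
  assumes "normalized_haar_SU2 \<mu>" "continuous_on UNIV h"
  shows "h \<in> borel_measurable \<mu>"
proof -
  have "h \<in> borel_measurable (restrict_space borel SU2)"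
    using assms(2) by (intro measurable_restrict_space1 borel_measurable_continuous_onI)
  moreover have "sets \<mu> = sets (restrict_space borel SU2)"
    using assms(1) by (simp add: normalized_haar_SU2_def)
  ultimately show ?thesis by (simp cong: measurable_cong_sets)
qed

lemma haar_translate:
  fixes h :: "complex^2^2 \<Rightarrow> complex"
  assumes "normalized_haar_SU2 \<mu>" "v \<in> SU2" "h \<in> borel_measurable \<mu>"
  shows "(\<integral>u. h (v ** u) \<partial>\<mu>) = (\<integral>u. h u \<partial>\<mu>)"
proof -
  have "continuous_on UNIV (\<lambda>u. v ** u)"
    unfolding matrix_matrix_mult_def by (intro continuous_intros)
  then have "(\<lambda>u. v ** u) \<in> measurable (restrict_space borel SU2) (restrict_space borel SU2)"
    using assms(2) SU2_mult by (intro measurable_restrict_space3 borel_measurable_continuous_onI) auto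
  moreover have s: "sets \<mu> = sets (restrict_space borel SU2)"
    using assms(1) by (simp add: normalized_haar_SU2_def)
  ultimately have m: "(\<lambda>u. v ** u) \<in> measurable \<mu> \<mu>" by (simp cong: measurable_cong_sets)
  have "(\<integral>u. h u \<partial>\<mu>) = (\<integral>u. h u \<partial>distr \<mu> \<mu> (\<lambda>u. v ** u))"
    using assms(1,2) by (simp add: normalized_haar_SU2_def)
  also have "\<dots> = (\<integral>u. h (v ** u) \<partial>\<mu>)"
    by (rule integral_distr[OF m assms(3)])
  finally show ?thesis ..
qed

text \<open>The inner product in L2 of two matrix coefficients. The column indices \<open>l\<close>
  and \<open>j\<close> will be held fixed while the row indices \<open>k\<close> and
  \<open>i\<close> run, which makes a matrix out of these numbers.\<close>

definition matrix_coeff_inner ::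
  "(complex^2^2) measure \<Rightarrow> (nat \<Rightarrow> nat \<Rightarrow> complex^2 \<Rightarrow> complex) \<Rightarrow> nat \<Rightarrow> nat \<Rightarrow> nat \<Rightarrow> nat \<Rightarrow> nat \<Rightarrow> nat \<Rightarrow> complex"
  where "matrix_coeff_inner \<mu> e m k l n i j =
    (\<integral>u. rep_matrix m (e m) u $$ (k, l) * cnj (rep_matrix n (e n) u $$ (i, j)) \<partial>\<mu>)"

context
  fixes \<mu> :: "(complex^2^2) measure" and e :: "nat \<Rightarrow> nat \<Rightarrow> complex^2 \<Rightarrow> complex"
  assumes haar: "normalized_haar_SU2 \<mu>" and unitarizing: "\<And>n. unitarizing_basis n (e n)"
begin

interpretation prob_space \<mu> using haar by (simp add: normalized_haar_SU2_def)

lemma basis_e: "hom_poly_basis n (e n)"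
  using unitarizing by (simp add: unitarizing_basis_def)

lemma unitary_rep: "u \<in> SU2 \<Longrightarrow> unitary_mat (n + 1) (rep_matrix n (e n) u)"
  using unitarizing by (simp add: unitarizing_basis_def)

lemma rep_measurable:
  "i \<le> n \<Longrightarrow> j \<le> n \<Longrightarrow> (\<lambda>u. rep_matrix n (e n) u $$ (i, j)) \<in> borel_measurable \<mu>"
  by (intro haar_borel_measurable[OF haar] continuous_rep_matrix[OF basis_e])

lemma rep_bounded:
  "i \<le> n \<Longrightarrow> j \<le> n \<Longrightarrow> u \<in> space \<mu> \<Longrightarrow> norm (rep_matrix n (e n) u $$ (i, j)) \<le> 1"
  using unitary_entry_le_1[OF unitary_rep] by (simp add: space_haar[OF haar])

lemma rep_product_integrable:
  assumes "k \<le> m" "l \<le> m" "i \<le> n" "j \<le> n"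
  shows "integrable \<mu> (\<lambda>u. rep_matrix m (e m) u $$ (k, l) * cnj (rep_matrix n (e n) u $$ (i, j)))"
proof (rule integrable_const_bound[where B = 1])
  show "AE u in \<mu>. norm (rep_matrix m (e m) u $$ (k, l) * cnj (rep_matrix n (e n) u $$ (i, j))) \<le> 1"
    using rep_bounded assms by (intro AE_I2) (simp add: norm_mult mult_le_one)
  show "(\<lambda>u. rep_matrix m (e m) u $$ (k, l) * cnj (rep_matrix n (e n) u $$ (i, j))) \<in> borel_measurable \<mu>"
    using rep_measurable assms
    by (intro borel_measurable_times borel_measurable_continuous_on[where f = cnj] continuous_intros) auto
qed

text \<open>Left translation by \<open>v\<close> mixes only the row indices. Written with matrices,
  the identity is \<open>Z = s Z t'\<close>, where \<open>s\<close> is the matrix of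
  \<open>v\<close> in degree \<open>m\<close> and \<open>t'\<close> the adjoint of its matrix in
  degree \<open>n\<close>.\<close>

lemma matrix_coeff_inner_translate:
  assumes "k \<le> m" "l \<le> m" "i \<le> n" "j \<le> n" "v \<in> SU2"
  shows "matrix_coeff_inner \<mu> e m k l n i j =
    (\<Sum>a\<le>n. (\<Sum>b\<le>m. rep_matrix m (e m) v $$ (k, b) * matrix_coeff_inner \<mu> e m b l n a j)
       * cnj (rep_matrix n (e n) v $$ (i, a)))"
proof -
  let ?s = "\<lambda>u. rep_matrix m (e m) u" and ?t = "\<lambda>u. rep_matrix n (e n) u"
  have meas: "(\<lambda>u. ?s u $$ (k, l) * cnj (?t u $$ (i, j))) \<in> borel_measurable \<mu>"
    by (rule borel_measurable_integrable[OF rep_product_integrable[OF assms(1-4)]])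
  have "matrix_coeff_inner \<mu> e m k l n i j = (\<integral>u. ?s (v ** u) $$ (k, l) * cnj (?t (v ** u) $$ (i, j)) \<partial>\<mu>)"
    unfolding matrix_coeff_inner_def by (rule haar_translate[OF haar assms(5) meas, symmetric])
  also have "\<dots> = (\<integral>u. (\<Sum>a\<le>n. \<Sum>b\<le>m. ?s v $$ (k, b) * cnj (?t v $$ (i, a))
      * (?s u $$ (b, l) * cnj (?t u $$ (a, j)))) \<partial>\<mu>)"
    unfolding rep_matrix_mult[OF basis_e assms(1,2)] rep_matrix_mult[OF basis_e assms(3,4)]
      cnj_sum sum_product
    by (subst sum.swap) (simp add: mult_ac)
  also have "\<dots> = (\<Sum>a\<le>n. \<integral>u. (\<Sum>b\<le>m. ?s v $$ (k, b) * cnj (?t v $$ (i, a))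
      * (?s u $$ (b, l) * cnj (?t u $$ (a, j)))) \<partial>\<mu>)"
    using assms by (intro Bochner_Integration.integral_sum Bochner_Integration.integrable_sum
        integrable_mult_right rep_product_integrable) auto
  also have "\<dots> = (\<Sum>a\<le>n. \<Sum>b\<le>m. \<integral>u. ?s v $$ (k, b) * cnj (?t v $$ (i, a))
      * (?s u $$ (b, l) * cnj (?t u $$ (a, j))) \<partial>\<mu>)"
    using assms by (intro sum.cong refl Bochner_Integration.integral_sum
        integrable_mult_right rep_product_integrable) auto
  also have "\<dots> = (\<Sum>a\<le>n. \<Sum>b\<le>m. ?s v $$ (k, b) * cnj (?t v $$ (i, a)) * matrix_coeff_inner \<mu> e m b l n a j)"
    by (simp add: matrix_coeff_inner_def)
  also have "\<dots> = (\<Sum>a\<le>n. (\<Sum>b\<le>m. ?s v $$ (k, b) * matrix_coeff_inner \<mu> e m b l n a j) * cnj (?t v $$ (i, a)))"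
    unfolding sum_distrib_right by (simp add: mult_ac)
  finally show ?thesis .
qed

text \<open>Multiplying the identity of \<open>matrix_coeff_inner_translate\<close> on the right by
  the unitary matrix of \<open>v\<close> cancels the adjoint.\<close>

lemma matrix_coeff_inner_intertwines:
  assumes "l \<le> m" "j \<le> n" "v \<in> SU2"
  defines "Z \<equiv> Matrix.mat (m+1) (n+1) (\<lambda>(k, i). matrix_coeff_inner \<mu> e m k l n i j)"
  shows "Z * rep_matrix n (e n) v = rep_matrix m (e m) v * Z"
proof -
  let ?s = "rep_matrix m (e m) v" and ?t = "rep_matrix n (e n) v"
  have Z: "Z \<in> carrier_mat (m+1) (n+1)" by (simp add: Z_def)
  have s: "?s \<in> carrier_mat (m+1) (m+1)" and t: "?t \<in> carrier_mat (n+1) (n+1)"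
    by (rule rep_matrix_carrier)+
  have sZ: "?s * Z \<in> carrier_mat (m+1) (n+1)" using s Z by (rule mult_carrier_mat)
  have t': "mat_adjoint ?t \<in> carrier_mat (n+1) (n+1)" using t by (auto simp: mat_adjoint_dim)
  have "Z = ?s * Z * mat_adjoint ?t"
  proof (rule eq_matI)
    fix k i assume "k < dim_row (?s * Z * mat_adjoint ?t)" "i < dim_col (?s * Z * mat_adjoint ?t)"
    then have ki: "k < m + 1" "i < n + 1" using s t' by auto
    then have ki': "k \<le> m" "i \<le> n" by auto
    have "(?s * Z * mat_adjoint ?t) $$ (k, i) = (\<Sum>a\<le>n. (?s * Z) $$ (k, a) * mat_adjoint ?t $$ (a, i))"
      by (rule mat_index_mult_sum[OF sZ t' ki])
    also have "\<dots> = (\<Sum>a\<le>n. (\<Sum>b\<le>m. ?s $$ (k, b) * matrix_coeff_inner \<mu> e m b l n a j) * cnj (?t $$ (i, a)))"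
    proof (intro sum.cong refl)
      fix a assume "a \<in> {..n}"
      then have a: "a < n + 1" by simp
      have "(?s * Z) $$ (k, a) = (\<Sum>b\<le>m. ?s $$ (k, b) * Z $$ (b, a))"
        by (rule mat_index_mult_sum[OF s Z ki(1) a])
      also have "\<dots> = (\<Sum>b\<le>m. ?s $$ (k, b) * matrix_coeff_inner \<mu> e m b l n a j)"
        using a by (intro sum.cong refl) (simp add: Z_def)
      finally show "(?s * Z) $$ (k, a) * mat_adjoint ?t $$ (a, i) =
          (\<Sum>b\<le>m. ?s $$ (k, b) * matrix_coeff_inner \<mu> e m b l n a j) * cnj (?t $$ (i, a))"
        using a ki t by (simp add: mat_adjoint_index)
    qed
    also have "\<dots> = Z $$ (k, i)"
      using matrix_coeff_inner_translate[OF ki'(1) assms(1) ki'(2) assms(2,3)] ki by (simp add: Z_def)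
    finally show "Z $$ (k, i) = (?s * Z * mat_adjoint ?t) $$ (k, i)" ..
  qed (use Z s t' in auto)
  then have "Z * ?t = ?s * Z * mat_adjoint ?t * ?t" by simp
  also have "\<dots> = ?s * Z * (mat_adjoint ?t * ?t)" by (rule assoc_mult_mat[OF sZ t' t])
  also have "mat_adjoint ?t * ?t = 1\<^sub>m (n+1)"
    using unitary_rep[OF assms(3), of n] by (simp add: unitary_mat_def)
  also have "?s * Z * 1\<^sub>m (n+1) = ?s * Z" by (rule right_mult_one_mat[OF sZ])
  finally show ?thesis .
qed

end

text \<open>The conjugate \<open>E' * Z * F\<close> intertwines the two monomial actions, so the
  lemmas above apply to it, and \<open>Z\<close> is recovered by the inverse matrices. For the
  scalar case the same pair \<open>E\<close>, \<open>F\<close> must serve on both sides: only then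
  does a scalar matrix conjugate back to a scalar one.\<close>

lemma basis_intertwiner_transfer:
  assumes basis: "hom_poly_basis n e" "hom_poly_basis m e'"
    and Z: "Z \<in> carrier_mat (m+1) (n+1)" "\<forall>u\<in>SU2. Z * rep_matrix n e u = rep_matrix m e' u * Z"
  shows "m < n \<Longrightarrow> Z = 0\<^sub>m (m+1) (n+1)"
    and "e' = e \<Longrightarrow> m = n \<Longrightarrow> \<exists>c. Z = c \<cdot>\<^sub>m 1\<^sub>m (n+1)"
proof -
  have *: "\<exists>E F. E \<in> carrier_mat (n+1) (n+1) \<and> F \<in> carrier_mat (n+1) (n+1) \<and>
    F * E = 1\<^sub>m (n+1) \<and> E * F = 1\<^sub>m (n+1) \<and> monomial_action n (\<lambda>u. E * rep_matrix n e u * F)"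
    if "hom_poly_basis n e" for n e
  proof -
    obtain E F where EF: "E \<in> carrier_mat (n+1) (n+1)" "F \<in> carrier_mat (n+1) (n+1)"
      "F * E = 1\<^sub>m (n+1)" "E * F = 1\<^sub>m (n+1)"
      and e: "\<And>j z. j \<le> n \<Longrightarrow> e j z = (\<Sum>k\<le>n. E $$ (k,j) * monomial_fun n k z)"
      "\<And>k z. k \<le> n \<Longrightarrow> monomial_fun n k z = (\<Sum>j\<le>n. F $$ (j,k) * e j z)"
      using basis_change[OF \<open>hom_poly_basis n e\<close>] by blast
    have "monomial_action n (\<lambda>u. E * rep_matrix n e u * F)"
      unfolding monomial_action_def
      using monomial_rep[OF that EF(1,2) e] EF(1,2) rep_matrix_carrier[of n e]
      by (meson mult_carrier_mat)
    with EF show ?thesis by blast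
  qed
  obtain E F where EF: "E \<in> carrier_mat (n+1) (n+1)" "F \<in> carrier_mat (n+1) (n+1)"
    "F * E = 1\<^sub>m (n+1)" "E * F = 1\<^sub>m (n+1)" and D: "monomial_action n (\<lambda>u. E * rep_matrix n e u * F)"
    using *[OF basis(1)] by blast
  have main: "E' * Z * F * (E * rep_matrix n e u * F) = E' * rep_matrix m e' u * F' * (E' * Z * F)"
    if u: "u \<in> SU2" and E': "E' \<in> carrier_mat (m+1) (m+1)" "F' \<in> carrier_mat (m+1) (m+1)" "F' * E' = 1\<^sub>m (m+1)"
    for u E' F'
  proof -
    let ?t = "rep_matrix n e u" and ?s = "rep_matrix m e' u"
    have t: "?t \<in> carrier_mat (n+1) (n+1)" and s: "?s \<in> carrier_mat (m+1) (m+1)"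
      by (rule rep_matrix_carrier)+
    \<comment> \<open>Products are normalized by nesting to the right, so the cancellations and the
      intertwining relation are stated with a trailing factor \<open>X\<close>.\<close>
    have FE: "F * (E * X) = X" if "dim_row X = n + 1" for X
      using EF that mat_mult_assoc_dim[of F E X] left_mult_one_mat[of X "n+1"] by auto
    have FE': "F' * (E' * X) = X" if "dim_row X = m + 1" for X
      using E' that mat_mult_assoc_dim[of F' E' X] left_mult_one_mat[of X "m+1"] by auto
    have Zt: "Z * (?t * X) = ?s * (Z * X)" if "dim_row X = n + 1" for X
    proof -
      have "Z * (?t * X) = Z * ?t * X"
        using that Z(1) t by (intro mat_mult_assoc_dim[symmetric]) auto
      also have "\<dots> = ?s * (Z * X)"
        unfolding bspec[OF Z(2) u] using that Z(1) s by (intro mat_mult_assoc_dim) auto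
      finally show ?thesis .
    qed
    show ?thesis
      using carrier_matD[OF E'(1)] carrier_matD[OF E'(2)] carrier_matD[OF EF(1)] carrier_matD[OF EF(2)]
        carrier_matD[OF t] carrier_matD[OF s] carrier_matD[OF Z(1)]
      by (simp add: mat_mult_assoc_dim FE FE' Zt)
  qed
  have recover: "F' * (E' * Z * F) * E = Z"
    if E': "E' \<in> carrier_mat (m+1) (m+1)" "F' \<in> carrier_mat (m+1) (m+1)" "F' * E' = 1\<^sub>m (m+1)" for E' F'
  proof -
    have "F' * (E' * Z * F) * E = (F' * E') * Z * (F * E)"
      using carrier_matD[OF E'(1)] carrier_matD[OF E'(2)] carrier_matD[OF EF(1)] carrier_matD[OF EF(2)]
        carrier_matD[OF Z(1)]
      by (simp add: mat_mult_assoc_dim)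
    also have "\<dots> = Z"
      unfolding E'(3) EF(3) using left_mult_one_mat[OF Z(1)] right_mult_one_mat[OF Z(1)] by simp
    finally show ?thesis .
  qed
  {
    assume "m < n"
    obtain E' F' where E': "E' \<in> carrier_mat (m+1) (m+1)" "F' \<in> carrier_mat (m+1) (m+1)" "F' * E' = 1\<^sub>m (m+1)"
      and D': "monomial_action m (\<lambda>u. E' * rep_matrix m e' u * F')"
      using *[OF basis(2)] by blast
    have W: "E' * Z * F \<in> carrier_mat (m+1) (n+1)"
      using E' Z(1) EF by (meson mult_carrier_mat)
    have "E' * Z * F = 0\<^sub>m (m+1) (n+1)"
      using main E' \<open>m < n\<close> by (intro intertwiner_zero[OF D D' W]) blast+
    with recover[OF E'] show "Z = 0\<^sub>m (m+1) (n+1)"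
      using E' EF(1) by (metis right_mult_zero_mat left_mult_zero_mat)
  }
  assume eq: "e' = e" "m = n"
  note E = EF(1,2,3)[folded eq(2)]
  have W: "E * Z * F \<in> carrier_mat (n+1) (n+1)"
    using Z(1) EF eq by (meson mult_carrier_mat)
  have "E * Z * F = (E * Z * F) $$ (n, n) \<cdot>\<^sub>m 1\<^sub>m (n+1)"
    using main[OF _ E] eq by (intro intertwiner_scalar[OF D W]) simp
  then obtain c where c: "E * Z * F = c \<cdot>\<^sub>m 1\<^sub>m (n+1)" by blast
  have "Z = F * (c \<cdot>\<^sub>m 1\<^sub>m (n+1)) * E" using recover[OF E] c by simp
  also have "\<dots> = c \<cdot>\<^sub>m (F * E)"
    unfolding mult_smult_distrib[OF EF(2) one_carrier_mat] right_mult_one_mat[OF EF(2)]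
    by (rule mult_smult_assoc_mat[OF EF(2,1)])
  finally show "\<exists>c. Z = c \<cdot>\<^sub>m 1\<^sub>m (n+1)" using EF(3) by auto
qed

subsection \<open>Schur orthogonality and Bessel's inequality\<close>

context
  fixes \<mu> :: "(complex^2^2) measure" and e :: "nat \<Rightarrow> nat \<Rightarrow> complex^2 \<Rightarrow> complex"
  assumes haar: "normalized_haar_SU2 \<mu>" and unitarizing: "\<And>n. unitarizing_basis n (e n)"
begin

interpretation prob_space \<mu> using haar by (simp add: normalized_haar_SU2_def)

lemma matrix_coeff_inner_less:
  assumes "k \<le> m" "l \<le> m" "i \<le> n" "j \<le> n" "m < n"
  shows "matrix_coeff_inner \<mu> e m k l n i j = 0"
proof -
  define Z where "Z = Matrix.mat (m+1) (n+1) (\<lambda>(k, i). matrix_coeff_inner \<mu> e m k l n i j)"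
  have "Z \<in> carrier_mat (m+1) (n+1)" "\<forall>v\<in>SU2. Z * rep_matrix n (e n) v = rep_matrix m (e m) v * Z"
    using matrix_coeff_inner_intertwines[OF haar unitarizing assms(2,4)] unfolding Z_def by simp_all
  from basis_intertwiner_transfer(1)[OF basis_e[OF haar unitarizing] basis_e[OF haar unitarizing] this assms(5)]
  have "Z = 0\<^sub>m (m+1) (n+1)" .
  then have "Z $$ (k, i) = 0" using assms by simp
  then show ?thesis using assms by (simp add: Z_def)
qed

text \<open>For fixed columns \<open>l\<close> and \<open>j\<close> the matrix is a scalar
  \<open>c\<close>, and its trace determines \<open>c\<close>.\<close>

lemma matrix_coeff_inner_eq:
  assumes "k \<le> n" "l \<le> n" "i \<le> n" "j \<le> n"
  shows "matrix_coeff_inner \<mu> e n k l n i j = (if k = i \<and> l = j then of_real (1 / real (n + 1)) else 0)"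
proof -
  define Z where "Z = Matrix.mat (n+1) (n+1) (\<lambda>(k, i). matrix_coeff_inner \<mu> e n k l n i j)"
  have "Z \<in> carrier_mat (n+1) (n+1)" "\<forall>v\<in>SU2. Z * rep_matrix n (e n) v = rep_matrix n (e n) v * Z"
    using matrix_coeff_inner_intertwines[OF haar unitarizing assms(2,4)] unfolding Z_def by simp_all
  from basis_intertwiner_transfer(2)[OF basis_e[OF haar unitarizing] basis_e[OF haar unitarizing] this refl refl]
  obtain c where c: "Z = c \<cdot>\<^sub>m 1\<^sub>m (n+1)" by blast
  have entry: "matrix_coeff_inner \<mu> e n k l n i j = (if k = i then c else 0)" if "k \<le> n" "i \<le> n" for k i
  proof -
    have "matrix_coeff_inner \<mu> e n k l n i j = Z $$ (k, i)" using that by (simp add: Z_def)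
    also have "\<dots> = (if k = i then c else 0)" unfolding c using that by simp
    finally show ?thesis .
  qed
  \<comment> \<open>Under the integral the trace becomes the inner product of the columns
    \<open>l\<close> and \<open>j\<close> of a unitary matrix, which is constant in
    \<open>u\<close>; the total mass 1 keeps that constant.\<close>
  have "of_nat (n + 1) * c = (\<Sum>k\<le>n. matrix_coeff_inner \<mu> e n k l n k j)"
    using entry by simp
  also have "\<dots> = (\<integral>u. (\<Sum>k\<le>n. rep_matrix n (e n) u $$ (k, l) * cnj (rep_matrix n (e n) u $$ (k, j))) \<partial>\<mu>)"
    unfolding matrix_coeff_inner_def using assms
    by (intro Bochner_Integration.integral_sum[symmetric] rep_product_integrable[OF haar unitarizing]) auto
  also have "\<dots> = (\<integral>u. (if j = l then 1 else 0) \<partial>\<mu>)"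
    using unitary_cols_orthonormal[OF unitary_rep[OF haar unitarizing] assms(4,2)]
    by (intro Bochner_Integration.integral_cong refl) (simp add: space_haar[OF haar])
  also have "\<dots> = (if j = l then 1 else 0)" by (simp add: prob_space)
  finally have "c * of_nat (n + 1) = (if j = l then 1 else 0)" by (simp only: mult.commute)
  then have "c = (if j = l then 1 else 0) / of_nat (n + 1)"
    by (subst nonzero_eq_divide_eq) (simp_all del: of_nat_add of_nat_Suc)
  then have "c = (if j = l then of_real (1 / real (n + 1)) else 0)" by simp
  then show ?thesis using entry[OF assms(1,3)] by auto
qed

text \<open>The vanishing lemma covers only \<open>m < n\<close>; the opposite case follows by
  complex conjugation, which exchanges the two coefficients.\<close>

lemma schur_orthogonality:
  assumes "k \<le> m" "l \<le> m" "i \<le> n" "j \<le> n"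
  shows "matrix_coeff_inner \<mu> e m k l n i j
    = (if m = n \<and> k = i \<and> l = j then of_real (1 / real (n + 1)) else 0)"
proof (cases m n rule: linorder_cases)
  case less
  then show ?thesis using matrix_coeff_inner_less assms by simp
next
  case equal
  then show ?thesis using matrix_coeff_inner_eq assms by simp
next
  case greater
  have "matrix_coeff_inner \<mu> e m k l n i j = cnj (matrix_coeff_inner \<mu> e n i j m k l)"
    unfolding matrix_coeff_inner_def Bochner_Integration.integral_cnj[symmetric] by (simp add: mult.commute)
  then show ?thesis using matrix_coeff_inner_less[OF assms(3,4,1,2) greater] greater by simp
qed

end

section \<open>Bessel's inequality and an L1 bound on a probability space\<close>

lemma (in prob_space) integrable_of_square_integrable:
  fixes f :: "'a \<Rightarrow> complex"
  assumes "f \<in> borel_measurable M" "integrable M (\<lambda>x. (norm (f x))\<^sup>2)"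
  shows "integrable M f"
proof (rule Bochner_Integration.integrable_bound)
  show "integrable M (\<lambda>x. 1 + (norm (f x))\<^sup>2)" using assms by simp
  have "norm (f x) \<le> norm (1 + (norm (f x))\<^sup>2)" for x
    using zero_le_power2[of "norm (f x) - 1"] by (simp add: power2_eq_square algebra_simps)
       (use zero_le_square[of "norm (f x)"] in linarith)
  then show "AE x in M. norm (f x) \<le> norm (1 + (norm (f x))\<^sup>2)" by simp
qed fact

lemma (in prob_space) bounded_times_integrable:
  fixes f g :: "'a \<Rightarrow> complex"
  assumes "integrable M f" "g \<in> borel_measurable M" "\<And>x. x \<in> space M \<Longrightarrow> norm (g x) \<le> B"
  shows "integrable M (\<lambda>x. f x * g x)"
proof (rule Bochner_Integration.integrable_bound)
  show "integrable M (\<lambda>x. B * norm (f x))" using assms by simp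
  show "(\<lambda>x. f x * g x) \<in> borel_measurable M" using assms by simp
  show "AE x in M. norm (f x * g x) \<le> norm (B * norm (f x))"
  proof (rule AE_I2)
    fix x assume x: "x \<in> space M"
    have "norm (f x) * norm (g x) \<le> norm (f x) * B"
      using assms(3)[OF x] by (intro mult_left_mono) auto
    also have "\<dots> \<le> \<bar>B\<bar> * norm (f x)" by (simp add: mult.commute mult_right_mono)
    finally show "norm (f x * g x) \<le> norm (B * norm (f x))" by (simp add: norm_mult abs_mult)
  qed
qed

text \<open>The system is orthogonal with squared norms \<open>w a\<close>, not normalized, because
  this is the form in which Schur orthogonality supplies it. The proof expands the nonnegative
  squared distance from \<open>f\<close> to its projection \<open>S\<close>; the bound on
  \<open>\<phi>\<close> provides integrability of all products.\<close>

lemma (in prob_space) bessel_inequality: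
  fixes \<phi> :: "'i \<Rightarrow> 'a \<Rightarrow> complex" and f :: "'a \<Rightarrow> complex"
  assumes fin: "finite I"
    and \<phi>: "\<And>a. a \<in> I \<Longrightarrow> \<phi> a \<in> borel_measurable M"
    and bdd: "\<And>a x. a \<in> I \<Longrightarrow> x \<in> space M \<Longrightarrow> norm (\<phi> a x) \<le> 1"
    and orth: "\<And>a b. a \<in> I \<Longrightarrow> b \<in> I \<Longrightarrow> (\<integral>x. \<phi> a x * cnj (\<phi> b x) \<partial>M) = (if a = b then of_real (w a) else 0)"
    and w: "\<And>a. a \<in> I \<Longrightarrow> w a > 0"
    and f: "f \<in> borel_measurable M" "integrable M (\<lambda>x. (norm (f x))\<^sup>2)"
  shows "(\<Sum>a\<in>I. (norm (\<integral>x. f x * cnj (\<phi> a x) \<partial>M))\<^sup>2 / w a) \<le> (\<integral>x. (norm (f x))\<^sup>2 \<partial>M)"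
proof -
  \<comment> \<open>The coefficients of the orthogonal projection of \<open>f\<close> onto the span
    of the system.\<close>
  define c where "c a = (\<integral>x. f x * cnj (\<phi> a x) \<partial>M) / of_real (w a)" for a
  define S where "S x = (\<Sum>a\<in>I. c a * \<phi> a x)" for x
  define T where "T = (\<Sum>a\<in>I. (norm (\<integral>x. f x * cnj (\<phi> a x) \<partial>M))\<^sup>2 / w a)"
  have T: "w a * (norm (c a))\<^sup>2 = (norm (\<integral>x. f x * cnj (\<phi> a x) \<partial>M))\<^sup>2 / w a" if "a \<in> I" for a
    using w[OF that] by (simp add: c_def norm_divide power_divide power2_eq_square)
  have cnj_meas: "(\<lambda>x. cnj (\<phi> a x)) \<in> borel_measurable M" if "a \<in> I" for a
    using \<phi>[OF that] by (intro borel_measurable_continuous_on[where f = cnj] continuous_intros)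
  have int_f\<phi>: "integrable M (\<lambda>x. f x * cnj (\<phi> a x))" if "a \<in> I" for a
    using bdd that cnj_meas
    by (intro bounded_times_integrable[OF integrable_of_square_integrable[OF f], where B = 1]) auto
  have int_\<phi>\<phi>: "integrable M (\<lambda>x. \<phi> a x * cnj (\<phi> b x))" if "a \<in> I" "b \<in> I" for a b
    using bdd that cnj_meas \<phi>
    by (intro bounded_times_integrable[where B = 1] integrable_const_bound[where B = 1] AE_I2) auto
  have fS: "f x * cnj (S x) = (\<Sum>a\<in>I. cnj (c a) * (f x * cnj (\<phi> a x)))" for x
    by (simp add: S_def sum_distrib_left mult_ac)
  have SS: "S x * cnj (S x) = (\<Sum>a\<in>I. \<Sum>b\<in>I. c a * cnj (c b) * (\<phi> a x * cnj (\<phi> b x)))" for x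
    unfolding S_def cnj_sum sum_product by (simp add: mult_ac)
  have int_fS: "integrable M (\<lambda>x. f x * cnj (S x))"
    unfolding fS by (intro Bochner_Integration.integrable_sum integrable_mult_right int_f\<phi>)
  have int_SS: "integrable M (\<lambda>x. S x * cnj (S x))"
    unfolding SS by (intro Bochner_Integration.integrable_sum integrable_mult_right int_\<phi>\<phi>)
  have "(\<integral>x. f x * cnj (S x) \<partial>M) = (\<Sum>a\<in>I. \<integral>x. cnj (c a) * (f x * cnj (\<phi> a x)) \<partial>M)"
    unfolding fS by (intro Bochner_Integration.integral_sum integrable_mult_right int_f\<phi>)
  also have "\<dots> = (\<Sum>a\<in>I. of_real (w a * (norm (c a))\<^sup>2))"
  proof (intro sum.cong refl)
    fix a assume a: "a \<in> I"
    have "(\<integral>x. cnj (c a) * (f x * cnj (\<phi> a x)) \<partial>M) = cnj (c a) * (of_real (w a) * c a)"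
      using w[OF a] by (simp add: c_def)
    also have "\<dots> = of_real (w a * (norm (c a))\<^sup>2)"
      unfolding of_real_mult complex_norm_square by (simp add: mult_ac)
    finally show "(\<integral>x. cnj (c a) * (f x * cnj (\<phi> a x)) \<partial>M) = of_real (w a * (norm (c a))\<^sup>2)" .
  qed
  also have "\<dots> = of_real T" unfolding T_def of_real_sum[symmetric] using T by simp
  finally have fS_T: "(\<integral>x. f x * cnj (S x) \<partial>M) = of_real T" .
  have "(\<integral>x. S x * cnj (S x) \<partial>M) = (\<Sum>a\<in>I. \<integral>x. (\<Sum>b\<in>I. c a * cnj (c b) * (\<phi> a x * cnj (\<phi> b x))) \<partial>M)"
    unfolding SS by (intro Bochner_Integration.integral_sum Bochner_Integration.integrable_sum integrable_mult_right int_\<phi>\<phi>)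
  also have "\<dots> = (\<Sum>a\<in>I. \<Sum>b\<in>I. \<integral>x. c a * cnj (c b) * (\<phi> a x * cnj (\<phi> b x)) \<partial>M)"
    by (intro sum.cong refl Bochner_Integration.integral_sum integrable_mult_right int_\<phi>\<phi>)
  also have "\<dots> = (\<Sum>a\<in>I. of_real (w a * (norm (c a))\<^sup>2))"
  proof (intro sum.cong refl)
    fix a assume a: "a \<in> I"
    have "(\<Sum>b\<in>I. \<integral>x. c a * cnj (c b) * (\<phi> a x * cnj (\<phi> b x)) \<partial>M)
      = (\<Sum>b\<in>I. if a = b then c a * cnj (c b) * of_real (w a) else 0)"
      using orth[OF a] by (intro sum.cong refl) simp
    also have "\<dots> = c a * cnj (c a) * of_real (w a)" using a fin by simp
    also have "\<dots> = of_real (w a * (norm (c a))\<^sup>2)"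
      unfolding of_real_mult complex_norm_square by (simp add: mult_ac)
    finally show "(\<Sum>b\<in>I. \<integral>x. c a * cnj (c b) * (\<phi> a x * cnj (\<phi> b x)) \<partial>M) = of_real (w a * (norm (c a))\<^sup>2)" .
  qed
  also have "\<dots> = of_real T" unfolding T_def of_real_sum[symmetric] using T by simp
  finally have SS_T: "(\<integral>x. S x * cnj (S x) \<partial>M) = of_real T" .
  have expand: "(norm (f x - S x))\<^sup>2 = (norm (f x))\<^sup>2 - 2 * Re (f x * cnj (S x)) + Re (S x * cnj (S x))" for x
    unfolding cmod_power2 by (simp add: power2_eq_square algebra_simps)
  have ints: "integrable M (\<lambda>x. Re (f x * cnj (S x)))" "integrable M (\<lambda>x. Re (S x * cnj (S x)))"
    by (intro integrable_Re int_fS int_SS)+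
  have "0 \<le> (\<integral>x. (norm (f x - S x))\<^sup>2 \<partial>M)" by simp
  also have "\<dots> = (\<integral>x. (norm (f x))\<^sup>2 \<partial>M) - 2 * Re (\<integral>x. f x * cnj (S x) \<partial>M) + Re (\<integral>x. S x * cnj (S x) \<partial>M)"
    unfolding expand integral_Re[OF int_fS, symmetric] integral_Re[OF int_SS, symmetric]
    using f(2) ints by (simp del: times_complex.sel)
  also have "\<dots> = (\<integral>x. (norm (f x))\<^sup>2 \<partial>M) - T" by (simp add: fS_T SS_T)
  finally show ?thesis by (simp add: T_def)
qed

text \<open>Minkowski's inequality for a vector-valued integral, by duality: the vector of integrals
  \<open>A\<close> is paired with itself under the integral, Cauchy--Schwarz bounds the integrand by
  \<open>S * K * norm (f x)\<close>, and one factor \<open>S\<close> is cancelled.\<close>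

lemma (in prob_space) L2_set_integral_le:
  fixes \<phi> :: "'i \<Rightarrow> 'a \<Rightarrow> complex" and f :: "'a \<Rightarrow> complex"
  assumes fin: "finite I"
    and \<phi>: "\<And>a. a \<in> I \<Longrightarrow> \<phi> a \<in> borel_measurable M"
    and bdd: "\<And>a x. a \<in> I \<Longrightarrow> x \<in> space M \<Longrightarrow> norm (\<phi> a x) \<le> 1"
    and K: "\<And>x. x \<in> space M \<Longrightarrow> L2_set (\<lambda>a. norm (\<phi> a x)) I \<le> K"
    and f: "integrable M f"
  shows "L2_set (\<lambda>a. norm (\<integral>x. f x * \<phi> a x \<partial>M)) I \<le> K * (\<integral>x. norm (f x) \<partial>M)"
proof -
  define A where "A a = (\<integral>x. f x * \<phi> a x \<partial>M)" for a
  define S where "S = L2_set (\<lambda>a. norm (A a)) I"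
  have S0: "S \<ge> 0" by (simp add: S_def)
  have int: "integrable M (\<lambda>x. f x * \<phi> a x)" if "a \<in> I" for a
    using \<phi> bdd that by (intro bounded_times_integrable[OF f, where B = 1]) auto
  have "of_real (S\<^sup>2) = (\<Sum>a\<in>I. cnj (A a) * A a)"
    unfolding S_def L2_set_def
    by (simp add: sum_nonneg complex_norm_square mult.commute del: of_real_power)
  also have "\<dots> = (\<Sum>a\<in>I. \<integral>x. cnj (A a) * (f x * \<phi> a x) \<partial>M)"
    by (simp add: A_def)
  also have "\<dots> = (\<integral>x. (\<Sum>a\<in>I. cnj (A a) * (f x * \<phi> a x)) \<partial>M)"
    by (intro Bochner_Integration.integral_sum[symmetric] integrable_mult_right int)
  finally have "S\<^sup>2 = norm (\<integral>x. (\<Sum>a\<in>I. cnj (A a) * (f x * \<phi> a x)) \<partial>M)"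
    by (metis norm_of_real abs_of_nonneg zero_le_power2)
  also have "\<dots> \<le> (\<integral>x. S * K * norm (f x) \<partial>M)"
  proof (rule order.trans[OF integral_norm_bound integral_mono])
    show "integrable M (\<lambda>x. norm (\<Sum>a\<in>I. cnj (A a) * (f x * \<phi> a x)))"
      by (intro integrable_norm Bochner_Integration.integrable_sum integrable_mult_right int)
    show "integrable M (\<lambda>x. S * K * norm (f x))" using f by simp
    fix x assume x: "x \<in> space M"
    have "norm (\<Sum>a\<in>I. cnj (A a) * (f x * \<phi> a x)) \<le> (\<Sum>a\<in>I. norm (cnj (A a) * (f x * \<phi> a x)))"
      by (rule norm_sum)
    also have "\<dots> = norm (f x) * (\<Sum>a\<in>I. \<bar>norm (A a)\<bar> * \<bar>norm (\<phi> a x)\<bar>)"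
      by (simp add: norm_mult sum_distrib_left mult_ac)
    also have "\<dots> \<le> norm (f x) * (S * L2_set (\<lambda>a. norm (\<phi> a x)) I)"
      unfolding S_def by (intro mult_left_mono L2_set_mult_ineq) auto
    also have "\<dots> \<le> norm (f x) * (S * K)"
      using K[OF x] S0 by (intro mult_left_mono) auto
    finally show "norm (\<Sum>a\<in>I. cnj (A a) * (f x * \<phi> a x)) \<le> S * K * norm (f x)" by (simp add: mult_ac)
  qed
  also have "\<dots> = S * (K * (\<integral>x. norm (f x) \<partial>M))" by simp
  finally have *: "S * S \<le> S * (K * (\<integral>x. norm (f x) \<partial>M))" by (simp add: power2_eq_square)
  show ?thesis
  proof (cases "S = 0")
    case True
    \<comment> \<open>If \<open>S = 0\<close> nothing can be cancelled, and \<open>0 \<le> K\<close>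
      is read off at some point of the space, which is nonempty because it has mass 1.\<close>
    obtain x where "x \<in> space M" using not_empty by blast
    then have "0 \<le> K" using K[of x] L2_set_nonneg order.trans by blast
    with True show ?thesis unfolding S_def A_def by simp
  next
    case False
    with S0 * show ?thesis unfolding S_def[symmetric] A_def[symmetric] by simp
  qed
qed

subsection \<open>Marcinkiewicz interpolation\<close>

lemma nn_integral_powr_0:
  assumes "a > -1" "c \<ge> 0"
  shows "(\<integral>\<^sup>+y. ennreal (y powr a) * indicator {0..c} y \<partial>lborel) = ennreal (c powr (a + 1) / (a + 1))"
  by (rule nn_integral_has_integral_lebesgue'[OF _ has_integral_powr_from_0[OF assms]]) simp

lemma nn_integral_powr_infinity:
  assumes "a < -1" "c > 0"
  shows "(\<integral>\<^sup>+y. ennreal (y powr a) * indicator {c..} y \<partial>lborel) = ennreal (c powr (a + 1) / (- a - 1))"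
proof -
  have "- (c powr (a + 1)) / (a + 1) = c powr (a + 1) / (- a - 1)"
    using assms by (simp add: field_simps)
  then show ?thesis
    using nn_integral_has_integral_lebesgue'[OF _ has_integral_powr_to_inf[OF assms]] by simp
qed

text \<open>The levels run only to \<open>t / 2\<close> because \<open>f\<close> will be split in
  two: if the value for \<open>f\<close> is at least \<open>2 * y\<close>, one of the two pieces has
  value at least \<open>y\<close>. The factor \<open>2 powr p\<close> compensates for this.\<close>

lemma powr_layer_cake:
  assumes "p > 0" "t \<ge> 0"
  shows "(\<integral>\<^sup>+y. ennreal (p * 2 powr p * y powr (p - 1)) * indicator {0..t / 2} y \<partial>lborel) = ennreal (t powr p)"
proof -
  have "(\<integral>\<^sup>+y. ennreal (p * 2 powr p * y powr (p - 1)) * indicator {0..t / 2} y \<partial>lborel)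
    = (\<integral>\<^sup>+y. ennreal (p * 2 powr p) * (ennreal (y powr (p - 1)) * indicator {0..t / 2} y) \<partial>lborel)"
    using assms by (intro nn_integral_cong) (simp add: ennreal_mult mult.assoc)
  also have "\<dots> = ennreal (p * 2 powr p) * ennreal ((t / 2) powr p / p)"
    using assms by (subst nn_integral_cmult) (simp_all add: nn_integral_powr_0)
  also have "\<dots> = ennreal (t powr p)"
    using assms by (simp add: ennreal_mult'[symmetric] powr_divide)
  finally show ?thesis .
qed

text \<open>The integral over all levels at a point where \<open>norm (f x) = a\<close>. Levels
  below \<open>a\<close> come from the weak (1,1) bound, levels above from the weak (2,2) bound.
  Convergence at 0 requires \<open>p > 1\<close> and at infinity \<open>p < 2\<close>, hence the two
  denominators.\<close>

lemma nn_integral_truncation_kernel: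
  assumes p: "1 < p" "p < 2" and AB: "0 \<le> A" "0 \<le> B" and a: "0 \<le> a"
  shows "(\<integral>\<^sup>+y. (ennreal (A * a * y powr (p - 2)) * indicator {0..a} y + ennreal (B * a\<^sup>2 * y powr (p - 3)) * indicator {a..} y) \<partial>lborel)
    \<le> ennreal ((A / (p - 1) + B / (2 - p)) * a powr p)"
proof (cases "a = 0")
  case True
  then show ?thesis by simp
next
  case False
  with a have a: "a > 0" by simp
  have "(\<integral>\<^sup>+y. (ennreal (A * a * y powr (p - 2)) * indicator {0..a} y + ennreal (B * a\<^sup>2 * y powr (p - 3)) * indicator {a..} y) \<partial>lborel)
    = (\<integral>\<^sup>+y. (ennreal (A * a) * (ennreal (y powr (p - 2)) * indicator {0..a} y) + ennreal (B * a\<^sup>2) * (ennreal (y powr (p - 3)) * indicator {a..} y)) \<partial>lborel)"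
    using AB a by (intro nn_integral_cong) (simp add: ennreal_mult mult.assoc)
  also have "\<dots> = ennreal (A * a) * ennreal (a powr (p - 1) / (p - 1)) + ennreal (B * a\<^sup>2) * ennreal (a powr (p - 2) / (2 - p))"
    using p a nn_integral_powr_0[of "p - 2" a] nn_integral_powr_infinity[of "p - 3" a]
    by (subst nn_integral_add) (simp_all add: nn_integral_cmult)
  also have "\<dots> = ennreal (A * a * (a powr (p - 1) / (p - 1)) + B * a\<^sup>2 * (a powr (p - 2) / (2 - p)))"
    using p AB a by (simp add: ennreal_mult'[symmetric] ennreal_plus)
  also have "A * a * (a powr (p - 1) / (p - 1)) + B * a\<^sup>2 * (a powr (p - 2) / (2 - p)) = (A / (p - 1) + B / (2 - p)) * a powr p"
  proof -
    have "a * a powr (p - 1) = a powr p" using powr_add[of a 1 "p - 1"] a by simp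
    moreover have "a\<^sup>2 * a powr (p - 2) = a powr p" using powr_add[of a 2 "p - 2"] a by simp
    moreover have "A * a * (a powr (p - 1) / (p - 1)) + B * a\<^sup>2 * (a powr (p - 2) / (2 - p))
      = A * (a * a powr (p - 1)) / (p - 1) + B * (a\<^sup>2 * a powr (p - 2)) / (2 - p)"
      by simp
    ultimately show ?thesis by (simp add: distrib_right)
  qed
  finally show ?thesis by simp
qed

text \<open>The target is the set of natural numbers with point masses \<open>w n\<close>, and the
  two weak-type bounds are written as sums over level sets. The sums are taken in
  \<open>ennreal\<close>, so convergence is part of the conclusion.\<close>

lemma (in prob_space) marcinkiewicz_interpolation:
  fixes T :: "nat \<Rightarrow> ('a \<Rightarrow> complex) \<Rightarrow> real" and w :: "nat \<Rightarrow> ennreal"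
  assumes p: "1 < p" "p < 2" and AB: "0 \<le> A" "0 \<le> B"
    and T_nonneg: "\<And>n g. 0 \<le> T n g"
    and subadd: "\<And>n g h. integrable M g \<Longrightarrow> integrable M h \<Longrightarrow> T n (\<lambda>x. g x + h x) \<le> T n g + T n h"
    and weak1: "\<And>g y. integrable M g \<Longrightarrow> 0 < y \<Longrightarrow>
      (\<Sum>n. w n * indicator {y..} (T n g)) \<le> ennreal (A / y * (\<integral>x. norm (g x) \<partial>M))"
    and weak2: "\<And>h y. h \<in> borel_measurable M \<Longrightarrow> integrable M (\<lambda>x. (norm (h x))\<^sup>2) \<Longrightarrow> 0 < y \<Longrightarrow>
      (\<Sum>n. w n * indicator {y..} (T n h)) \<le> ennreal (B / y\<^sup>2 * (\<integral>x. (norm (h x))\<^sup>2 \<partial>M))"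
    and f: "f \<in> borel_measurable M" "integrable M (\<lambda>x. norm (f x) powr p)"
  shows "(\<Sum>n. w n * ennreal (T n f powr p))
    \<le> ennreal (p * 2 powr p * (A / (p - 1) + B / (2 - p)) * (\<integral>x. norm (f x) powr p \<partial>M))"
proof -
  define C where "C = p * 2 powr p"
  have C: "C > 0" using p by (simp add: C_def)
  \<comment> \<open>On a probability space L^p lies in L^1 for \<open>p > 1\<close>, so the (1,1)
    hypothesis and subadditivity are available for the pieces of \<open>f\<close>.\<close>
  have f_int: "integrable M f"
  proof (rule Bochner_Integration.integrable_bound)
    show "integrable M (\<lambda>x. 1 + norm (f x) powr p)" using f by simp
    have "norm (f x) \<le> norm (1 + norm (f x) powr p)" for x
    proof (cases "norm (f x) \<le> 1")
      case True
      then show ?thesis by (simp add: add_increasing2)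
    next
      case False
      then have "norm (f x) powr 1 \<le> norm (f x) powr p" using p by (intro powr_mono) auto
      then show ?thesis using False by simp
    qed
    then show "AE x in M. norm (f x) \<le> norm (1 + norm (f x) powr p)" by simp
  qed (rule f)
  \<comment> \<open>After the truncation at height \<open>y\<close>, this kernel dominates
    \<open>y powr (p - 1)\<close> times the integrands of the two weak-type bounds. Its joint
    measurability is what allows the integrals over \<open>x\<close> and \<open>y\<close> to be
    exchanged.\<close>
  define k where "k x y = ennreal (A * norm (f x) * y powr (p - 2)) * (if 0 \<le> y \<and> y \<le> norm (f x) then 1 else 0)
    + ennreal (B * (norm (f x))\<^sup>2 * y powr (p - 3)) * (if norm (f x) \<le> y then 1 else 0)" for x and y :: real
  note f(1)[measurable]
  have k_measurable: "case_prod k \<in> borel_measurable (M \<Otimes>\<^sub>M lborel)"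
    unfolding k_def by measurable
  have k_measurable': "case_prod (\<lambda>y x. k x y) \<in> borel_measurable (lborel \<Otimes>\<^sub>M M)"
    unfolding k_def by measurable
  have layer: "(\<Sum>n. w n * (ennreal (C * y powr (p - 1)) * indicator {0..T n f / 2} y))
      \<le> ennreal C * (\<integral>\<^sup>+x. k x y \<partial>M)" for y
  proof (cases "y > 0")
    case False
    \<comment> \<open>The weak-type bounds need \<open>y > 0\<close>. Negative levels lie outside
      the interval, and at \<open>y = 0\<close> the factor \<open>0 powr (p - 1)\<close> is
      0.\<close>
    then have "ennreal (C * y powr (p - 1)) * indicator {0..T n f / 2} y = 0" for n
      by (cases "y = 0") (auto simp: indicator_def)
    then show ?thesis by (simp only: mult_zero_right suminf_zero) simp
  next
    case y: True
    \<comment> \<open>The truncation height equals the level \<open>y\<close>: the large part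
      \<open>G\<close> is handled in L^1, while \<open>H\<close> is bounded by \<open>y\<close> and
      hence lies in L^2.\<close>
    define G where "G x = (if y < norm (f x) then f x else 0)" for x
    define H where "H x = (if y < norm (f x) then 0 else f x)" for x
    have [measurable]: "G \<in> borel_measurable M" "H \<in> borel_measurable M"
      unfolding G_def H_def by measurable
    have G: "integrable M G"
      by (rule Bochner_Integration.integrable_bound[OF f_int]) (auto simp: G_def)
    have H: "integrable M H"
      by (rule Bochner_Integration.integrable_bound[OF f_int]) (auto simp: H_def)
    have H2: "integrable M (\<lambda>x. (norm (H x))\<^sup>2)"
      by (rule integrable_const_bound[where B = "y\<^sup>2"]) (auto simp: H_def intro!: power_mono)
    have fGH: "(\<lambda>x. G x + H x) = f" by (auto simp: G_def H_def)
    have ind: "indicator {0..T n f / 2} y \<le> (indicator {y..} (T n G) + indicator {y..} (T n H) :: ennreal)" for n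
      using subadd[OF G H, of n] unfolding fGH by (auto simp: indicator_def)
    have "(\<Sum>n. w n * indicator {0..T n f / 2} y) \<le> (\<Sum>n. w n * indicator {y..} (T n G) + w n * indicator {y..} (T n H))"
      by (intro suminf_le) (auto simp: distrib_left[symmetric] intro!: mult_left_mono ind)
    also have "\<dots> = (\<Sum>n. w n * indicator {y..} (T n G)) + (\<Sum>n. w n * indicator {y..} (T n H))"
      by (intro suminf_add[symmetric]) auto
    also have "\<dots> \<le> ennreal (A / y * (\<integral>x. norm (G x) \<partial>M)) + ennreal (B / y\<^sup>2 * (\<integral>x. (norm (H x))\<^sup>2 \<partial>M))"
      using H2 y by (intro add_mono weak1 weak2 G) auto
    also have "\<dots> = (\<integral>\<^sup>+x. ennreal (A / y * norm (G x)) \<partial>M) + (\<integral>\<^sup>+x. ennreal (B / y\<^sup>2 * (norm (H x))\<^sup>2) \<partial>M)"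
      using G H2 AB y by (subst (1 2) nn_integral_eq_integral) auto
    also have "\<dots> = (\<integral>\<^sup>+x. ennreal (A / y * norm (G x)) + ennreal (B / y\<^sup>2 * (norm (H x))\<^sup>2) \<partial>M)"
      by (intro nn_integral_add[symmetric]) auto
    finally have bound: "(\<Sum>n. w n * indicator {0..T n f / 2} y)
      \<le> (\<integral>\<^sup>+x. ennreal (A / y * norm (G x)) + ennreal (B / y\<^sup>2 * (norm (H x))\<^sup>2) \<partial>M)" .
    have powr: "y powr (p - 1) / y = y powr (p - 2)" "y powr (p - 1) / y\<^sup>2 = y powr (p - 3)"
      using y powr_diff[of y "p - 1" 1] powr_diff[of y "p - 1" 2] by simp_all
    have pointwise: "ennreal (y powr (p - 1)) * (ennreal (A / y * norm (G x)) + ennreal (B / y\<^sup>2 * (norm (H x))\<^sup>2)) \<le> k x y" for x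
    proof -
      have "y powr (p - 1) * (A / y * norm (G x)) = A * norm (G x) * (y powr (p - 1) / y)"
        "y powr (p - 1) * (B / y\<^sup>2 * (norm (H x))\<^sup>2) = B * (norm (H x))\<^sup>2 * (y powr (p - 1) / y\<^sup>2)"
        by simp_all
      then have "ennreal (y powr (p - 1)) * (ennreal (A / y * norm (G x)) + ennreal (B / y\<^sup>2 * (norm (H x))\<^sup>2))
        = ennreal (A * norm (G x) * y powr (p - 2)) + ennreal (B * (norm (H x))\<^sup>2 * y powr (p - 3))"
        using AB y by (simp only: distrib_left powr ennreal_mult'[symmetric] powr_ge_zero)
      \<comment> \<open>At \<open>y = norm (f x)\<close> both terms of \<open>k\<close> are present
        although \<open>G x\<close> is 0, so only an inequality holds.\<close>
      also have "\<dots> \<le> k x y" using y by (simp add: k_def G_def H_def)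
      finally show ?thesis .
    qed
    have "(\<Sum>n. w n * (ennreal (C * y powr (p - 1)) * indicator {0..T n f / 2} y))
      = (\<Sum>n. ennreal (C * y powr (p - 1)) * (w n * indicator {0..T n f / 2} y))"
      by (simp only: mult.left_commute)
    also have "\<dots> = ennreal C * (ennreal (y powr (p - 1)) * (\<Sum>n. w n * indicator {0..T n f / 2} y))"
      using C by (simp add: ennreal_suminf_cmult ennreal_mult mult.assoc)
    also have "\<dots> \<le> ennreal C * (ennreal (y powr (p - 1)) * (\<integral>\<^sup>+x. ennreal (A / y * norm (G x)) + ennreal (B / y\<^sup>2 * (norm (H x))\<^sup>2) \<partial>M))"
      by (intro mult_left_mono bound) auto
    also have "\<dots> = ennreal C * (\<integral>\<^sup>+x. ennreal (y powr (p - 1)) * (ennreal (A / y * norm (G x)) + ennreal (B / y\<^sup>2 * (norm (H x))\<^sup>2)) \<partial>M)"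
      by (subst nn_integral_cmult) auto
    also have "\<dots> \<le> ennreal C * (\<integral>\<^sup>+x. k x y \<partial>M)"
      by (intro mult_left_mono nn_integral_mono pointwise) auto
    finally show ?thesis .
  qed
  note inner_measurable = borel_measurable_nn_integral[OF k_measurable']
  interpret pair_sigma_finite M lborel ..
  have "(\<Sum>n. w n * ennreal (T n f powr p))
    = (\<Sum>n. w n * (\<integral>\<^sup>+y. ennreal (C * y powr (p - 1)) * indicator {0..T n f / 2} y \<partial>lborel))"
    using p by (simp add: C_def powr_layer_cake T_nonneg)
  also have "\<dots> = (\<Sum>n. \<integral>\<^sup>+y. w n * (ennreal (C * y powr (p - 1)) * indicator {0..T n f / 2} y) \<partial>lborel)"
    by (subst nn_integral_cmult) auto
  also have "\<dots> = (\<integral>\<^sup>+y. (\<Sum>n. w n * (ennreal (C * y powr (p - 1)) * indicator {0..T n f / 2} y)) \<partial>lborel)"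
    by (intro nn_integral_suminf[symmetric]) auto
  also have "\<dots> \<le> (\<integral>\<^sup>+y. ennreal C * (\<integral>\<^sup>+x. k x y \<partial>M) \<partial>lborel)"
    by (intro nn_integral_mono layer)
  also have "\<dots> = ennreal C * (\<integral>\<^sup>+y. (\<integral>\<^sup>+x. k x y \<partial>M) \<partial>lborel)"
    by (rule nn_integral_cmult[OF inner_measurable])
  also have "\<dots> = ennreal C * (\<integral>\<^sup>+x. (\<integral>\<^sup>+y. k x y \<partial>lborel) \<partial>M)"
    by (simp only: Fubini'[OF k_measurable])
  also have "\<dots> \<le> ennreal C * (\<integral>\<^sup>+x. ennreal ((A / (p - 1) + B / (2 - p)) * norm (f x) powr p) \<partial>M)"
  proof (intro mult_left_mono nn_integral_mono)
    fix x
    show "(\<integral>\<^sup>+y. k x y \<partial>lborel) \<le> ennreal ((A / (p - 1) + B / (2 - p)) * norm (f x) powr p)"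
      using nn_integral_truncation_kernel[OF p AB, of "norm (f x)"]
      by (simp add: k_def indicator_def of_bool_def)
  qed auto
  also have "\<dots> = ennreal C * ennreal ((A / (p - 1) + B / (2 - p)) * (\<integral>x. norm (f x) powr p \<partial>M))"
    using f(2) p AB by (subst nn_integral_eq_integral) auto
  also have "\<dots> = ennreal (p * 2 powr p * (A / (p - 1) + B / (2 - p)) * (\<integral>x. norm (f x) powr p \<partial>M))"
    using C by (simp add: ennreal_mult'[symmetric] C_def mult.assoc)
  finally show ?thesis .
qed

subsection \<open>The Hardy--Littlewood inequality\<close>

lemma ennreal_suminf_le:
  fixes f :: "nat \<Rightarrow> ennreal"
  assumes "\<And>N. (\<Sum>n<N. f n) \<le> c"
  shows "(\<Sum>n. f n) \<le> c"
  unfolding suminf_eq_SUP using assms by (rule SUP_least)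

lemma summable_of_ennreal_suminf_le:
  fixes f :: "nat \<Rightarrow> real"
  assumes "\<And>n. 0 \<le> f n" "(\<Sum>n. ennreal (f n)) \<le> ennreal c" "0 \<le> c"
  shows "summable f" "(\<Sum>n. f n) \<le> c"
proof -
  have "(\<Sum>n. ennreal (f n)) \<noteq> \<infinity>"
    using assms(2) by (auto simp: top_unique)
  then show *: "summable f" by (intro summable_suminf_not_top[OF assms(1)]) simp
  show "(\<Sum>n. f n) \<le> c"
    using assms(2,3) suminf_ennreal2[OF assms(1) *] by simp
qed

text \<open>With \<open>d = n + 1\<close> and \<open>e = d + 1\<close>, clearing denominators leaves
  \<open>e ^ 3 \<le> 2 * d * (e ^ 3 - d ^ 3)\<close>, that is
  \<open>1 + d \<le> 3 * d ^ 2 + 5 * d ^ 3\<close>, which holds for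
  \<open>d \<ge> 1\<close>.\<close>

lemma inverse_fourth_power_telescope:
  "1 / real (n + 1) ^ 4 \<le> 2 / real (n + 1) ^ 3 - 2 / real (n + 2) ^ 3"
proof -
  define d where "d = real (n + 1)"
  have d: "d \<ge> 1" by (simp add: d_def)
  have "(d + 1) ^ 3 \<le> 2 * d * ((d + 1) ^ 3 - d ^ 3)"
  proof -
    have "d \<le> d * d" "0 \<le> d * (d * d)" using d by simp_all
    then have "1 + d \<le> d * (d * 3) + d * (d * (d * 5))" using d by linarith
    then show ?thesis by (simp add: power3_eq_cube algebra_simps)
  qed
  moreover define e where "e = d + 1"
  ultimately have "e ^ 3 / (d ^ 4 * e ^ 3) \<le> 2 * d * (e ^ 3 - d ^ 3) / (d ^ 4 * e ^ 3)"
    using d by (intro divide_right_mono) auto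
  also have "\<dots> = 2 / d ^ 3 - 2 / e ^ 3"
  proof -
    have "0 < d" "0 < e" using d by (simp_all add: e_def)
    then show ?thesis by (simp add: field_simps eval_nat_numeral)
  qed
  finally have "1 / d ^ 4 \<le> 2 / d ^ 3 - 2 / (d + 1) ^ 3"
    using d by (simp add: e_def)
  then show ?thesis by (simp add: d_def add.commute)
qed

lemma inverse_fourth_power_tail:
  "(\<Sum>n. ennreal (real (n + 1) powr (-4)) * (if n0 \<le> n then 1 else 0)) \<le> ennreal (2 / real (n0 + 1) ^ 3)"
proof (rule ennreal_suminf_le)
  fix N
  \<comment> \<open>The subtracted term is kept so that the induction telescopes; it is dropped only
    afterwards.\<close>
  have "(\<Sum>n<N. if n0 \<le> n then 1 / real (n + 1) ^ 4 else 0)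
    \<le> (if n0 \<le> N then 2 / real (n0 + 1) ^ 3 - 2 / real (N + 1) ^ 3 else 0)"
  proof (induction N)
    case 0
    then show ?case by simp
  next
    case (Suc N)
    show ?case
    proof (cases "n0 \<le> N")
      case True
      then show ?thesis using Suc inverse_fourth_power_telescope[of N] by simp
    next
      case False
      then have "(if n0 \<le> Suc N then 2 / real (n0 + 1) ^ 3 - 2 / real (Suc N + 1) ^ 3 else 0) = 0"
        by (cases "n0 = Suc N") auto
      then show ?thesis using False Suc by simp
    qed
  qed
  also have "\<dots> \<le> 2 / real (n0 + 1) ^ 3" by simp
  finally have "ennreal (\<Sum>n<N. if n0 \<le> n then 1 / real (n + 1) ^ 4 else 0) \<le> ennreal (2 / real (n0 + 1) ^ 3)"
    by (rule ennreal_leI)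
  moreover have "(\<Sum>n<N. ennreal (real (n + 1) powr (-4)) * (if n0 \<le> n then 1 else 0))
    = ennreal (\<Sum>n<N. if n0 \<le> n then 1 / real (n + 1) ^ 4 else 0)"
  proof -
    have "ennreal (real (n + 1) powr (-4)) * (if n0 \<le> n then 1 else 0)
      = ennreal (if n0 \<le> n then 1 / real (n + 1) ^ 4 else 0)" for n
      by (simp add: powr_minus_divide)
    then show ?thesis by (subst sum_ennreal[symmetric]) auto
  qed
  ultimately show "(\<Sum>n<N. ennreal (real (n + 1) powr (-4)) * (if n0 \<le> n then 1 else 0)) \<le> ennreal (2 / real (n0 + 1) ^ 3)"
    by simp
qed

text \<open>The set where \<open>y \<le> T n\<close> lies in the tail starting at its least element
  \<open>n0\<close>. At \<open>n0\<close> the growth bound gives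
  \<open>y \<le> (n0 + 1) ^ 3 * G\<close>, which turns the tail estimate
  \<open>2 / (n0 + 1) ^ 3\<close> into \<open>2 / y * G\<close>.\<close>

lemma inverse_fourth_power_level_sum:
  assumes T: "\<And>n. T n \<le> real (n + 1) ^ 3 * G" and G: "0 \<le> G" and y: "0 < y"
  shows "(\<Sum>n. ennreal (real (n + 1) powr (-4)) * indicator {y..} (T n)) \<le> ennreal (2 / y * G)"
proof (cases "\<exists>n. y \<le> T n")
  case False
  then have "(\<Sum>n. ennreal (real (n + 1) powr (-4)) * indicator {y..} (T n)) = (\<Sum>n::nat. 0)"
    by (intro suminf_cong) (simp add: indicator_def)
  then show ?thesis by simp
next
  case True
  define n0 where "n0 = (LEAST n. y \<le> T n)"
  have n0: "y \<le> T n0" unfolding n0_def using True by (rule LeastI_ex)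
  have "(\<Sum>n. ennreal (real (n + 1) powr (-4)) * indicator {y..} (T n))
    \<le> (\<Sum>n. ennreal (real (n + 1) powr (-4)) * (if n0 \<le> n then 1 else 0))"
    by (intro suminf_le mult_left_mono) (auto simp: indicator_def n0_def Least_le)
  also have "\<dots> \<le> ennreal (2 / real (n0 + 1) ^ 3)" by (rule inverse_fourth_power_tail)
  also have "\<dots> \<le> ennreal (2 / y * G)"
  proof (rule ennreal_leI)
    have "y \<le> real (n0 + 1) ^ 3 * G" using n0 T[of n0] by linarith
    then show "2 / real (n0 + 1) ^ 3 \<le> 2 / y * G" using y by (simp add: field_simps)
  qed
  finally show ?thesis .
qed

section \<open>Hilbert--Schmidt norms of Fourier coefficients\<close>

lemma hs_norm_nonneg: "0 \<le> hs_norm M"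
  unfolding hs_norm_sum by (intro real_sqrt_ge_zero sum_nonneg) simp

text \<open>The adjoint in the Fourier coefficient exchanges the indices, but summing over all pairs
  is insensitive to transposition.\<close>

lemma hs_norm_fourier_coeff:
  "hs_norm (fourier_coeff \<mu> e f n) =
    L2_set (\<lambda>(i, j). norm (\<integral>u. f u * cnj (rep_matrix n e u $$ (i, j)) \<partial>\<mu>)) ({..n} \<times> {..n})"
proof -
  have entry: "fourier_coeff \<mu> e f n $$ (i, j) = (\<integral>u. f u * cnj (rep_matrix n e u $$ (j, i)) \<partial>\<mu>)"
    if "i \<le> n" "j \<le> n" for i j
    using that by (simp add: fourier_coeff_def mat_adjoint_index carrier_matD[OF rep_matrix_carrier])
  have "(\<Sum>i<dim_row (fourier_coeff \<mu> e f n). \<Sum>j<dim_col (fourier_coeff \<mu> e f n). (norm (fourier_coeff \<mu> e f n $$ (i,j)))\<^sup>2)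
    = (\<Sum>i\<le>n. \<Sum>j\<le>n. (norm (\<integral>u. f u * cnj (rep_matrix n e u $$ (j, i)) \<partial>\<mu>))\<^sup>2)"
    using entry by (intro sum.cong) (auto simp: fourier_coeff_def lessThan_Suc_atMost[symmetric])
  also have "\<dots> = (\<Sum>(i,j)\<in>{..n}\<times>{..n}. (norm (\<integral>u. f u * cnj (rep_matrix n e u $$ (i, j)) \<partial>\<mu>))\<^sup>2)"
    by (subst sum.swap) (simp add: sum.cartesian_product)
  finally show ?thesis
    unfolding hs_norm_sum L2_set_def by (simp add: case_prod_beta)
qed

context
  fixes \<mu> :: "(complex^2^2) measure" and e :: "nat \<Rightarrow> nat \<Rightarrow> complex^2 \<Rightarrow> complex"
  assumes haar: "normalized_haar_SU2 \<mu>" and unitarizing: "\<And>n. unitarizing_basis n (e n)"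
begin

interpretation prob_space \<mu> using haar by (simp add: normalized_haar_SU2_def)

lemma cnj_rep_measurable:
  "i \<le> n \<Longrightarrow> j \<le> n \<Longrightarrow> (\<lambda>u. cnj (rep_matrix n (e n) u $$ (i, j))) \<in> borel_measurable \<mu>"
  by (intro borel_measurable_continuous_on[where f = cnj] continuous_intros
      rep_measurable[OF haar unitarizing])

lemma cnj_rep_bounded:
  "i \<le> n \<Longrightarrow> j \<le> n \<Longrightarrow> u \<in> space \<mu> \<Longrightarrow> norm (cnj (rep_matrix n (e n) u $$ (i, j))) \<le> 1"
  using rep_bounded[OF haar unitarizing] by simp

text \<open>A unitary matrix of size \<open>n + 1\<close> has Hilbert--Schmidt norm
  \<open>sqrt (n + 1)\<close>, which is the constant \<open>K\<close> of
  \<open>L2_set_integral_le\<close>.\<close>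

lemma hs_norm_fourier_le_L1:
  assumes "integrable \<mu> f"
  shows "hs_norm (fourier_coeff \<mu> (e n) f n) \<le> sqrt (real (n + 1)) * (\<integral>u. norm (f u) \<partial>\<mu>)"
proof -
  let ?\<phi> = "\<lambda>(i, j) u. cnj (rep_matrix n (e n) u $$ (i, j))"
  have "L2_set (\<lambda>a. norm (?\<phi> a u)) ({..n} \<times> {..n}) \<le> sqrt (real (n + 1))" if "u \<in> space \<mu>" for u
  proof -
    have U: "unitary_mat (n+1) (rep_matrix n (e n) u)"
      using unitary_rep[OF haar unitarizing] that space_haar[OF haar] by simp
    have "complex_of_real (\<Sum>i\<le>n. \<Sum>j\<le>n. (norm (rep_matrix n (e n) u $$ (i, j)))\<^sup>2) = of_real (real (n + 1))"
      unfolding of_real_sum complex_norm_square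
      using unitary_rows_orthonormal[OF U] by simp
    then have "(\<Sum>i\<le>n. \<Sum>j\<le>n. (norm (rep_matrix n (e n) u $$ (i, j)))\<^sup>2) = real (n + 1)"
      by (simp only: of_real_eq_iff)
    then show ?thesis
      by (simp add: L2_set_def sum.cartesian_product case_prod_beta)
  qed
  then have "L2_set (\<lambda>a. norm (\<integral>u. f u * ?\<phi> a u \<partial>\<mu>)) ({..n} \<times> {..n})
      \<le> sqrt (real (n + 1)) * (\<integral>u. norm (f u) \<partial>\<mu>)"
    using cnj_rep_measurable cnj_rep_bounded by (intro L2_set_integral_le assms) (auto simp: case_prod_beta)
  then show ?thesis by (simp add: hs_norm_fourier_coeff case_prod_unfold)
qed

lemma hs_norm_fourier_add_le:
  assumes "integrable \<mu> f" "integrable \<mu> g"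
  shows "hs_norm (fourier_coeff \<mu> (e n) (\<lambda>u. f u + g u) n)
    \<le> hs_norm (fourier_coeff \<mu> (e n) f n) + hs_norm (fourier_coeff \<mu> (e n) g n)"
proof -
  let ?c = "\<lambda>f i j. \<integral>u. f u * cnj (rep_matrix n (e n) u $$ (i, j)) \<partial>\<mu>"
  have add: "?c (\<lambda>u. f u + g u) i j = ?c f i j + ?c g i j" if "i \<le> n" "j \<le> n" for i j
    unfolding distrib_right using that
    by (intro Bochner_Integration.integral_add bounded_times_integrable[where B = 1] assms
        cnj_rep_measurable cnj_rep_bounded)
  have "L2_set (\<lambda>(i, j). norm (?c (\<lambda>u. f u + g u) i j)) ({..n} \<times> {..n})
    \<le> L2_set (\<lambda>a. (\<lambda>(i, j). norm (?c f i j)) a + (\<lambda>(i, j). norm (?c g i j)) a) ({..n} \<times> {..n})"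
    by (intro L2_set_mono) (auto simp: add norm_triangle_ineq)
  also have "\<dots> \<le> L2_set (\<lambda>(i, j). norm (?c f i j)) ({..n} \<times> {..n}) + L2_set (\<lambda>(i, j). norm (?c g i j)) ({..n} \<times> {..n})"
    by (rule L2_set_triangle_ineq)
  finally show ?thesis by (simp only: hs_norm_fourier_coeff)
qed

text \<open>By Schur orthogonality the coefficients of degree \<open>n\<close> have squared norm
  \<open>1 / (n + 1)\<close>; dividing by it produces the factor \<open>n + 1\<close>. Finitely many
  degrees give a bound independent of \<open>N\<close>.\<close>

lemma bessel_SU2:
  assumes "h \<in> borel_measurable \<mu>" "integrable \<mu> (\<lambda>u. (norm (h u))\<^sup>2)"
  shows "(\<Sum>n. ennreal (real (n + 1) * (hs_norm (fourier_coeff \<mu> (e n) h n))\<^sup>2))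
    \<le> ennreal (\<integral>u. (norm (h u))\<^sup>2 \<partial>\<mu>)"
proof (rule ennreal_suminf_le)
  fix N :: nat
  let ?\<phi> = "\<lambda>(n, i, j) u. rep_matrix n (e n) u $$ (i, j)"
  let ?w = "\<lambda>a::nat \<times> nat \<times> nat. 1 / real (fst a + 1)"
  let ?I = "SIGMA n:{..<N}. {..n} \<times> {..n}"
  have "(\<Sum>n<N. real (n + 1) * (hs_norm (fourier_coeff \<mu> (e n) h n))\<^sup>2)
    = (\<Sum>n<N. \<Sum>(i, j)\<in>{..n} \<times> {..n}. (norm (\<integral>u. h u * cnj (?\<phi> (n, i, j) u) \<partial>\<mu>))\<^sup>2 / ?w (n, i, j))"
    by (intro sum.cong refl)
      (simp add: hs_norm_fourier_coeff L2_set_def sum_nonneg sum_distrib_left case_prod_beta mult.commute)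
  also have "\<dots> = (\<Sum>a\<in>?I. (norm (\<integral>u. h u * cnj (?\<phi> a u) \<partial>\<mu>))\<^sup>2 / ?w a)"
    by (subst sum.Sigma) (auto simp: case_prod_beta)
  also have "\<dots> \<le> (\<integral>u. (norm (h u))\<^sup>2 \<partial>\<mu>)"
  proof (rule bessel_inequality[OF _ _ _ _ _ assms])
    show "?\<phi> a \<in> borel_measurable \<mu>" if "a \<in> ?I" for a
      using that rep_measurable[OF haar unitarizing] by auto
    show "norm (?\<phi> a u) \<le> 1" if "a \<in> ?I" "u \<in> space \<mu>" for a u
      using that rep_bounded[OF haar unitarizing] by auto
    show "(\<integral>u. ?\<phi> a u * cnj (?\<phi> b u) \<partial>\<mu>) = (if a = b then of_real (?w a) else 0)"
      if "a \<in> ?I" "b \<in> ?I" for a b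
      using that schur_orthogonality[OF haar unitarizing, unfolded matrix_coeff_inner_def]
      by (auto simp del: of_real_divide split: if_splits)
  qed auto
  finally show "(\<Sum>n<N. ennreal (real (n + 1) * (hs_norm (fourier_coeff \<mu> (e n) h n))\<^sup>2)) \<le> ennreal (\<integral>u. (norm (h u))\<^sup>2 \<partial>\<mu>)"
    by (subst sum_ennreal) (auto intro: ennreal_leI)
qed

lemma hardy_littlewood_SU2:
  assumes p: "1 < p" "p < 2" and f: "f \<in> borel_measurable \<mu>" "integrable \<mu> (\<lambda>u. norm (f u) powr p)"
  shows "(\<Sum>n. ennreal (real (n + 1) powr (5 / 2 * p - 4) * hs_norm (fourier_coeff \<mu> (e n) f n) powr p))
    \<le> ennreal (p * 2 powr p * (2 / (p - 1) + 1 / (2 - p)) * (\<integral>u. norm (f u) powr p \<partial>\<mu>))"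
proof -
  define T where "T n g = real (n + 1) powr (5 / 2) * hs_norm (fourier_coeff \<mu> (e n) g n)" for n g
  define w where "w n = ennreal (real (n + 1) powr (-4))" for n
  have "(\<Sum>n. w n * ennreal (T n f powr p))
    \<le> ennreal (p * 2 powr p * (2 / (p - 1) + 1 / (2 - p)) * (\<integral>u. norm (f u) powr p \<partial>\<mu>))"
  \<comment> \<open>The constants are \<open>A = 2\<close>, from the tail of inverse fourth powers,
    and \<open>B = 1\<close>, from Bessel's inequality.\<close>
  proof (rule marcinkiewicz_interpolation[OF p _ _ _ _ _ _ f])
    show "0 \<le> T n g" for n g by (simp add: T_def hs_norm_nonneg)
    show "T n (\<lambda>u. g u + h u) \<le> T n g + T n h" if "integrable \<mu> g" "integrable \<mu> h" for n g h
      unfolding T_def distrib_left[symmetric] using that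
      by (intro mult_left_mono hs_norm_fourier_add_le) auto
    show "(\<Sum>n. w n * indicator {y..} (T n g)) \<le> ennreal (2 / y * (\<integral>u. norm (g u) \<partial>\<mu>))"
      if g: "integrable \<mu> g" and y: "0 < y" for g y
      unfolding w_def
    proof (rule inverse_fourth_power_level_sum[OF _ _ y])
      show "T n g \<le> real (n + 1) ^ 3 * (\<integral>u. norm (g u) \<partial>\<mu>)" for n
      proof -
        have "T n g \<le> real (n + 1) powr (5 / 2) * (sqrt (real (n + 1)) * (\<integral>u. norm (g u) \<partial>\<mu>))"
          unfolding T_def by (intro mult_left_mono hs_norm_fourier_le_L1 g) auto
        also have "real (n + 1) powr (5 / 2) * (sqrt (real (n + 1)) * (\<integral>u. norm (g u) \<partial>\<mu>))
          = real (n + 1) powr (5 / 2 + 1 / 2) * (\<integral>u. norm (g u) \<partial>\<mu>)"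
          by (simp only: powr_add powr_half_sqrt of_nat_0_le_iff mult.assoc)
        also have "real (n + 1) powr (5 / 2 + 1 / 2) = real (n + 1) ^ 3" by simp
        finally show ?thesis .
      qed
    qed simp
    show "(\<Sum>n. w n * indicator {y..} (T n h)) \<le> ennreal (1 / y\<^sup>2 * (\<integral>u. (norm (h u))\<^sup>2 \<partial>\<mu>))"
      if h: "h \<in> borel_measurable \<mu>" "integrable \<mu> (\<lambda>u. (norm (h u))\<^sup>2)" and y: "0 < y" for h y
    proof -
      \<comment> \<open>Chebyshev's argument: on the level set the indicator is at most
        \<open>(T n h / y)\<close> squared. The exponents \<open>-4\<close> and twice
        \<open>5 / 2\<close> add up to 1, leaving exactly the weight \<open>n + 1\<close> of
        Bessel's inequality.\<close>
      have "w n * indicator {y..} (T n h) \<le> ennreal (1 / y\<^sup>2) * ennreal (real (n + 1) * (hs_norm (fourier_coeff \<mu> (e n) h n))\<^sup>2)" for n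
      proof (cases "y \<le> T n h")
        case True
        have "y\<^sup>2 \<le> (T n h)\<^sup>2" using True y by (intro power_mono) auto
        then have "1 \<le> (T n h)\<^sup>2 / y\<^sup>2" using y by simp
        then have "real (n + 1) powr (-4) * 1 \<le> real (n + 1) powr (-4) * ((T n h)\<^sup>2 / y\<^sup>2)"
          by (intro mult_left_mono) auto
        also have "\<dots> = 1 / y\<^sup>2 * ((real (n + 1) powr (-4) * (real (n + 1) powr (5 / 2))\<^sup>2) * (hs_norm (fourier_coeff \<mu> (e n) h n))\<^sup>2)"
          by (simp add: T_def power_mult_distrib)
        also have "real (n + 1) powr (-4) * (real (n + 1) powr (5 / 2))\<^sup>2 = real (n + 1) powr (-4 + (5 / 2 + 5 / 2))"
          by (simp only: powr_add power2_eq_square)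
        also have "\<dots> = real (n + 1)" by simp
        finally have "ennreal (real (n + 1) powr (-4)) \<le> ennreal (1 / y\<^sup>2 * (real (n + 1) * (hs_norm (fourier_coeff \<mu> (e n) h n))\<^sup>2))"
          by (intro ennreal_leI) simp
        also have "\<dots> = ennreal (1 / y\<^sup>2) * ennreal (real (n + 1) * (hs_norm (fourier_coeff \<mu> (e n) h n))\<^sup>2)"
          by (rule ennreal_mult') simp
        finally show ?thesis using True by (simp add: w_def)
      next
        case False
        then show ?thesis by simp
      qed
      then have "(\<Sum>n. w n * indicator {y..} (T n h))
        \<le> (\<Sum>n. ennreal (1 / y\<^sup>2) * ennreal (real (n + 1) * (hs_norm (fourier_coeff \<mu> (e n) h n))\<^sup>2))"
        by (intro suminf_le) auto
      also have "\<dots> = ennreal (1 / y\<^sup>2) * (\<Sum>n. ennreal (real (n + 1) * (hs_norm (fourier_coeff \<mu> (e n) h n))\<^sup>2))"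
        by (rule ennreal_suminf_cmult)
      also have "\<dots> \<le> ennreal (1 / y\<^sup>2) * ennreal (\<integral>u. (norm (h u))\<^sup>2 \<partial>\<mu>)"
        by (intro mult_left_mono bessel_SU2 h) auto
      also have "\<dots> = ennreal (1 / y\<^sup>2 * (\<integral>u. (norm (h u))\<^sup>2 \<partial>\<mu>))"
        by (rule ennreal_mult'[symmetric]) simp
      finally show ?thesis .
    qed
  qed auto
  moreover have "w n * ennreal (T n f powr p)
    = ennreal (real (n + 1) powr (5 / 2 * p - 4) * hs_norm (fourier_coeff \<mu> (e n) f n) powr p)" for n
  proof -
    have "real (n + 1) powr (-4) * T n f powr p
      = (real (n + 1) powr (-4) * real (n + 1) powr (5 / 2 * p)) * hs_norm (fourier_coeff \<mu> (e n) f n) powr p"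
      unfolding T_def by (subst powr_mult) (simp_all only: powr_powr mult.assoc hs_norm_nonneg powr_ge_zero)
    also have "real (n + 1) powr (-4) * real (n + 1) powr (5 / 2 * p) = real (n + 1) powr (5 / 2 * p - 4)"
      by (simp add: powr_add[symmetric])
    finally show ?thesis by (simp only: w_def ennreal_mult'[symmetric] powr_ge_zero)
  qed
  ultimately show ?thesis by simp
qed

end

theorem theorem2p2:
  fixes p :: real
  assumes "1 < p" and "p \<le> 2"
  shows "\<exists>c>0. \<forall>\<mu> e f.
    normalized_haar_SU2 \<mu> \<longrightarrow> (\<forall>n. unitarizing_basis n (e n)) \<longrightarrow> f \<in> Lp_space p \<mu> \<longrightarrow>
      summable (\<lambda>n. real (n + 1) powr (5 / 2 * p - 4) * hs_norm (fourier_coeff \<mu> (e n) f n) powr p) \<and>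
      (\<Sum>n. real (n + 1) powr (5 / 2 * p - 4) * hs_norm (fourier_coeff \<mu> (e n) f n) powr p)
        \<le> c * Lp_norm p \<mu> f powr p"
proof -
  have Lp: "Lp_norm p \<mu> f powr p = (\<integral>u. norm (f u) powr p \<partial>\<mu>)" for \<mu> :: "(complex^2^2) measure" and f
    using assms(1) by (simp add: Lp_norm_def powr_powr)
  have "\<exists>c>0. \<forall>\<mu> e f. normalized_haar_SU2 \<mu> \<longrightarrow> (\<forall>n. unitarizing_basis n (e n)) \<longrightarrow> f \<in> Lp_space p \<mu> \<longrightarrow>
      (\<Sum>n. ennreal (real (n + 1) powr (5 / 2 * p - 4) * hs_norm (fourier_coeff \<mu> (e n) f n) powr p))
        \<le> ennreal (c * (\<integral>u. norm (f u) powr p \<partial>\<mu>))"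
  proof (cases "p = 2")
    case False
    with assms have p: "1 < p" "p < 2" by auto
    then have "0 < p * 2 powr p * (2 / (p - 1) + 1 / (2 - p))"
      by (intro mult_pos_pos add_pos_pos divide_pos_pos) auto
    then show ?thesis
      using hardy_littlewood_SU2[OF _ _ p] unfolding Lp_space_def by blast
  next
    \<comment> \<open>The interpolation constant contains \<open>1 / (2 - p)\<close> and is of no
      use here. At the endpoint the exponent \<open>5 / 2 * p - 4\<close> equals 1 and the claim is
      Bessel's inequality with constant 1.\<close>
    case True
    have sq: "x powr p = x\<^sup>2" if "0 \<le> x" for x :: real
      using that True by (cases "x = 0") auto
    have exponent: "x powr (5 / 2 * p - 4) = x" if "0 \<le> x" for x :: real
      using that True by simp
    have *: "(\<Sum>n. ennreal (real (n + 1) powr (5 / 2 * p - 4) * hs_norm (fourier_coeff \<mu> (e n) f n) powr p))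
        \<le> ennreal (1 * (\<integral>u. norm (f u) powr p \<partial>\<mu>))"
      if haar: "normalized_haar_SU2 \<mu>" and e: "\<forall>n. unitarizing_basis n (e n)" and f: "f \<in> Lp_space p \<mu>"
      for \<mu> e f
    proof -
      have "f \<in> borel_measurable \<mu>" "integrable \<mu> (\<lambda>u. (norm (f u))\<^sup>2)"
        using f unfolding Lp_space_def sq[OF norm_ge_zero] by auto
      from bessel_SU2[OF haar spec[OF e] this] show ?thesis
        unfolding sq[OF norm_ge_zero] sq[OF hs_norm_nonneg] exponent[OF of_nat_0_le_iff] mult_1_left .
    qed
    have "(0::real) < 1" by simp
    with * show ?thesis
      by (intro exI[of _ "1::real"] conjI allI impI)
  qed
  then obtain c where c: "c > 0" and bound: "\<And>\<mu> e f. normalized_haar_SU2 \<mu> \<Longrightarrow> (\<forall>n. unitarizing_basis n (e n)) \<Longrightarrow>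
      f \<in> Lp_space p \<mu> \<Longrightarrow>
      (\<Sum>n. ennreal (real (n + 1) powr (5 / 2 * p - 4) * hs_norm (fourier_coeff \<mu> (e n) f n) powr p))
        \<le> ennreal (c * (\<integral>u. norm (f u) powr p \<partial>\<mu>))" by blast
  show ?thesis
  proof (rule exI[of _ c], intro conjI allI impI c)
    fix \<mu> :: "(complex^2^2) measure" and e f
    assume "normalized_haar_SU2 \<mu>" "\<forall>n. unitarizing_basis n (e n)" "f \<in> Lp_space p \<mu>"
    note bound = bound[OF this]
    have nonneg: "0 \<le> real (n + 1) powr (5 / 2 * p - 4) * hs_norm (fourier_coeff \<mu> (e n) f n) powr p" for n
      by simp
    have c0: "0 \<le> c * (\<integral>u. norm (f u) powr p \<partial>\<mu>)"
      using c by simp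
    show "summable (\<lambda>n. real (n + 1) powr (5 / 2 * p - 4) * hs_norm (fourier_coeff \<mu> (e n) f n) powr p)"
      by (rule summable_of_ennreal_suminf_le(1)[OF nonneg bound c0])
    show "(\<Sum>n. real (n + 1) powr (5 / 2 * p - 4) * hs_norm (fourier_coeff \<mu> (e n) f n) powr p)
        \<le> c * Lp_norm p \<mu> f powr p"
      unfolding Lp by (rule summable_of_ennreal_suminf_le(2)[OF nonneg bound c0])
  qed
qed

end
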